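(* Let ${\cal N}=(D,s,t,c)$ be a flow network. If $\lambda_D(s,t)\ge 2$, then there exists a maximum $(s,t)$-flow $x$ on ${\cal N}$ such that $\lambda_{D_x}(s,t)\ge 2$. In particular, it can be decided in polynomial time whether a network ${\cal N}$ admits a maximum flow $x$ with $\lambda_{D_x}(s,t)\ge 2$.
   Context: A flow network ${\cal N}=(D,s,t,c)$ consists of a digraph $D$, a source $s$, a sink $t$ and non-negative integer arc capacities $c$. All flows are integer valued: an $(s,t)$-flow $x$ assigns to each arc $uv$ an integer $0\le x(uv)\le c(uv)$ with flow conservation at every vertex other than $s,t$; its value is the net amount of flow leaving $s$; a maximum flow is one of maximum value. The support digraph $D_x$ is the subdigraph of $D$ with arc set $\{uv\in A(D): x(uv)>0\}$. For a digraph $H$, $\lambda_H(s,t)$ is the maximum number of pairwise arc-disjoint directed paths from $s$ to $t$ in $H$.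
   Formalization: The hypothesis λ_D(s,t) ≥ 2 is imposed on the subdigraph of arcs with positive capacity, since with zero capacities allowed the claim is false (two disjoint paths, all capacities 0); source and sink are assumed distinct. *)

theory Defs
  imports
    "Graph_Theory.Arc_Walk"
    "HOL-Computational_Algebra.Polynomial"
begin

section \<open>Flow networks\<close>

text \<open>
  Arcs are named, so parallel arcs and loops are permitted; simple digraphs are the special
  case of the locale \<^locale>\<open>digraph\<close>.  Capacities and flows take values in \<^typ>\<open>nat\<close>, i.e. they
  are non-negative and integral; in particular zero capacities are allowed.  Values of
  \<^term>\<open>c\<close> and \<^term>\<open>x\<close> at elements outside \<^term>\<open>arcs D\<close> are irrelevant.
\<close>

definition flow_network ::
    "('a, 'b) pre_digraph \<Rightarrow> 'a \<Rightarrow> 'a \<Rightarrow> ('b \<Rightarrow> nat) \<Rightarrow> bool" where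
  "flow_network D s t c \<longleftrightarrow>
     fin_digraph D \<and> s \<in> verts D \<and> t \<in> verts D \<and> s \<noteq> t"

definition st_flow ::
    "('a, 'b) pre_digraph \<Rightarrow> 'a \<Rightarrow> 'a \<Rightarrow> ('b \<Rightarrow> nat) \<Rightarrow> ('b \<Rightarrow> nat) \<Rightarrow> bool" where
  "st_flow D s t c x \<longleftrightarrow>
     (\<forall>a \<in> arcs D. x a \<le> c a) \<and>
     (\<forall>v \<in> verts D - {s, t}. (\<Sum>a \<in> in_arcs D v. x a) = (\<Sum>a \<in> out_arcs D v. x a))"

definition flow_value :: "('a, 'b) pre_digraph \<Rightarrow> 'a \<Rightarrow> ('b \<Rightarrow> nat) \<Rightarrow> int" where
  "flow_value D s x = (\<Sum>a \<in> out_arcs D s. int (x a)) - (\<Sum>a \<in> in_arcs D s. int (x a))"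

definition maximum_st_flow ::
    "('a, 'b) pre_digraph \<Rightarrow> 'a \<Rightarrow> 'a \<Rightarrow> ('b \<Rightarrow> nat) \<Rightarrow> ('b \<Rightarrow> nat) \<Rightarrow> bool" where
  "maximum_st_flow D s t c x \<longleftrightarrow>
     st_flow D s t c x \<and> (\<forall>y. st_flow D s t c y \<longrightarrow> flow_value D s y \<le> flow_value D s x)"

definition support_digraph ::
    "('a, 'b) pre_digraph \<Rightarrow> ('b \<Rightarrow> nat) \<Rightarrow> ('a, 'b) pre_digraph" where
  "support_digraph D x = D\<lparr>arcs := {a \<in> arcs D. 0 < x a}\<rparr>"

text \<open>
  A path is given by its list of arcs.  For distinct endpoints no path is empty, so arc-disjoint
  paths are distinct and counting the elements of a set counts the paths.
\<close>

definition arc_disjoint_paths ::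
    "('a, 'b) pre_digraph \<Rightarrow> 'a \<Rightarrow> 'a \<Rightarrow> 'b list set \<Rightarrow> bool" where
  "arc_disjoint_paths H s t P \<longleftrightarrow>
     (\<forall>p \<in> P. pre_digraph.apath H s p t) \<and>
     (\<forall>p \<in> P. \<forall>q \<in> P. p \<noteq> q \<longrightarrow> set p \<inter> set q = {})"

definition local_arc_connectivity ::
    "('a, 'b) pre_digraph \<Rightarrow> 'a \<Rightarrow> 'a \<Rightarrow> nat" where
  "local_arc_connectivity H s t = Max {card P | P. arc_disjoint_paths H s t P}"

text \<open>
  An arc of capacity \<open>0\<close> cannot carry flow.  The existence result is false if such arcs may be
  used by the two arc-disjoint paths of the hypothesis: with all capacities \<open>0\<close> the only flow
  is \<open>0\<close>, whose support has no arcs.  Its hypothesis is therefore imposed on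
  \<^term>\<open>support_digraph D c\<close>, which is \<^term>\<open>D\<close> itself whenever all capacities are positive.
\<close>

lemma support_digraph_eq_self:
  assumes "\<forall>a \<in> arcs D. 0 < c a"
  shows "support_digraph D c = D"
proof -
  have "{a \<in> arcs D. 0 < c a} = arcs D" using assms by blast
  then show ?thesis by (simp add: support_digraph_def)
qed


section \<open>Polynomial time\<close>

text \<open>
  The model of computation is the WHILE language of N. D. Jones (Computability and Complexity
  from a Programming Perspective): structured programs over binary trees, where every operation
  of an expression and every test costs one unit.  Since values can be shared as pointers, and
  can only be inspected by taking components and testing for the atom, this running time is
  polynomially related to that of Turing machines.
\<close>

datatype tree = Atom | Node tree tree

fun left :: "tree \<Rightarrow> tree" where
  "left Atom = Atom"
| "left (Node l r) = l"

fun right :: "tree \<Rightarrow> tree" where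
  "right Atom = Atom"
| "right (Node l r) = r"

type_synonym state = "nat \<Rightarrow> tree"

datatype exp = V nat | AtomE | NodeE exp exp | LeftE exp | RightE exp

fun val :: "exp \<Rightarrow> state \<Rightarrow> tree" where
  "val (V i) \<sigma> = \<sigma> i"
| "val AtomE \<sigma> = Atom"
| "val (NodeE e f) \<sigma> = Node (val e \<sigma>) (val f \<sigma>)"
| "val (LeftE e) \<sigma> = left (val e \<sigma>)"
| "val (RightE e) \<sigma> = right (val e \<sigma>)"

fun cost :: "exp \<Rightarrow> nat" where
  "cost (V i) = 1"
| "cost AtomE = 1"
| "cost (NodeE e f) = 1 + cost e + cost f"
| "cost (LeftE e) = 1 + cost e"
| "cost (RightE e) = 1 + cost e"

datatype com =
    Skip
  | Assign nat exp
  | Seq com com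
  | Cond exp com com
  | While exp com

text \<open>\<open>exec C \<sigma> k \<tau>\<close>: program \<open>C\<close>, started in \<open>\<sigma>\<close>, halts in \<open>\<tau>\<close> after time \<open>k\<close>.\<close>

inductive exec :: "com \<Rightarrow> state \<Rightarrow> nat \<Rightarrow> state \<Rightarrow> bool" where
  Skip: "exec Skip \<sigma> 1 \<sigma>"
| Assign: "exec (Assign i e) \<sigma> (1 + cost e) (\<sigma>(i := val e \<sigma>))"
| Seq: "exec C \<sigma> k \<sigma>' \<Longrightarrow> exec D \<sigma>' m \<tau> \<Longrightarrow> exec (Seq C D) \<sigma> (k + m) \<tau>"
| CondTrue: "val e \<sigma> \<noteq> Atom \<Longrightarrow> exec C \<sigma> k \<tau> \<Longrightarrow> exec (Cond e C D) \<sigma> (1 + cost e + k) \<tau>"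
| CondFalse: "val e \<sigma> = Atom \<Longrightarrow> exec D \<sigma> k \<tau> \<Longrightarrow> exec (Cond e C D) \<sigma> (1 + cost e + k) \<tau>"
| WhileTrue: "val e \<sigma> \<noteq> Atom \<Longrightarrow> exec C \<sigma> k \<sigma>' \<Longrightarrow> exec (While e C) \<sigma>' m \<tau> \<Longrightarrow>
    exec (While e C) \<sigma> (1 + cost e + k + m) \<tau>"
| WhileFalse: "val e \<sigma> = Atom \<Longrightarrow> exec (While e C) \<sigma> (1 + cost e) \<sigma>"

inductive_cases exec_elims:
  "exec Skip \<sigma> k \<tau>"
  "exec (Assign i e) \<sigma> k \<tau>"
  "exec (Seq C D) \<sigma> k \<tau>"
  "exec (Cond e C D) \<sigma> k \<tau>"
  "exec (While e C) \<sigma> k \<tau>"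

lemma exec_deterministic:
  "exec C \<sigma> k \<tau> \<Longrightarrow> exec C \<sigma> k' \<tau>' \<Longrightarrow> k' = k \<and> \<tau>' = \<tau>"
proof (induction arbitrary: k' \<tau>' rule: exec.induct)
  case (Skip \<sigma>)
  from Skip.prems show ?case by (rule exec_elims(1)) simp
next
  case (Assign i e \<sigma>)
  from Assign.prems show ?case by (rule exec_elims(2)) simp
next
  case (Seq C \<sigma> k \<sigma>' D m \<tau>)
  from Seq.prems show ?case
    by (rule exec_elims(3)) (metis Seq.IH)
next
  case (CondTrue e \<sigma> C k \<tau> D)
  from CondTrue.prems show ?case
    by (rule exec_elims(4)) (use CondTrue.hyps(1) in \<open>auto dest: CondTrue.IH\<close>)
next
  case (CondFalse e \<sigma> D k \<tau> C)
  from CondFalse.prems show ?case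
    by (rule exec_elims(4)) (use CondFalse.hyps(1) in \<open>auto dest: CondFalse.IH\<close>)
next
  case (WhileTrue e \<sigma> C k \<sigma>' m \<tau>)
  from WhileTrue.prems show ?case
    by (rule exec_elims(5)) (use WhileTrue.hyps(1) in \<open>auto dest!: WhileTrue.IH\<close>)
next
  case (WhileFalse e \<sigma> C)
  from WhileFalse.prems show ?case
    by (rule exec_elims(5)) (use WhileFalse.hyps(1) in auto)
qed

text \<open>
  The property \<open>Q\<close> of the instances in \<open>I\<close>, presented through the encoding \<open>enc\<close>, is decided by
  one program within time polynomial in the size of the encoding (the number of \<^const>\<open>Node\<close>s).
  Variable \<open>0\<close> holds the input at the start and the answer at the end.
\<close>

definition poly_time_decidable :: "('i \<Rightarrow> tree) \<Rightarrow> 'i set \<Rightarrow> ('i \<Rightarrow> bool) \<Rightarrow> bool" where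
  "poly_time_decidable enc I Q \<longleftrightarrow>
     (\<exists>C. \<exists>q :: nat poly. \<forall>i \<in> I. \<exists>k \<tau>.
        exec C ((\<lambda>_. Atom)(0 := enc i)) k \<tau> \<and>
        k \<le> poly q (size (enc i)) \<and>
        (\<tau> 0 \<noteq> Atom \<longleftrightarrow> Q i))"


section \<open>Networks as inputs\<close>

text \<open>
  As an input, a network is given by the list of its vertices, the list of its arcs as triples
  (tail, head, capacity), the source and the sink.  All numbers are encoded in binary.
\<close>

record network =
  vertex_list :: "nat list"
  arc_list :: "(nat \<times> nat \<times> nat) list"
  source :: nat
  sink :: nat

definition net_digraph :: "network \<Rightarrow> (nat, nat) pre_digraph" where
  "net_digraph N =
     \<lparr>verts = set (vertex_list N), arcs = {..<length (arc_list N)},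
      tail = (\<lambda>i. fst (arc_list N ! i)), head = (\<lambda>i. fst (snd (arc_list N ! i)))\<rparr>"

definition net_capacity :: "network \<Rightarrow> nat \<Rightarrow> nat" where
  "net_capacity N i = snd (snd (arc_list N ! i))"

definition networks :: "network set" where
  "networks = {N. distinct (vertex_list N) \<and>
     flow_network (net_digraph N) (source N) (sink N) (net_capacity N)}"

text \<open>Least significant bit first; a bit \<open>1\<close> is \<^term>\<open>Node Atom Atom\<close>, a bit \<open>0\<close> is \<^term>\<open>Atom\<close>.\<close>

fun enc_nat :: "nat \<Rightarrow> tree" where
  "enc_nat n = (if n = 0 then Atom
     else Node (if odd n then Node Atom Atom else Atom) (enc_nat (n div 2)))"

declare enc_nat.simps [simp del]

fun enc_list :: "('x \<Rightarrow> tree) \<Rightarrow> 'x list \<Rightarrow> tree" where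
  "enc_list enc [] = Atom"
| "enc_list enc (x # xs) = Node (enc x) (enc_list enc xs)"

fun enc_pair :: "('x \<Rightarrow> tree) \<Rightarrow> ('y \<Rightarrow> tree) \<Rightarrow> 'x \<times> 'y \<Rightarrow> tree" where
  "enc_pair enc1 enc2 (x, y) = Node (enc1 x) (enc2 y)"

definition enc_network :: "network \<Rightarrow> tree" where
  "enc_network N =
     Node (enc_list enc_nat (vertex_list N))
       (Node (enc_list (enc_pair enc_nat (enc_pair enc_nat enc_nat)) (arc_list N))
         (Node (enc_nat (source N)) (enc_nat (sink N))))"

end

theory Submission
  imports Defs
begin

text \<open>
  By Menger's theorem for two paths, \<open>\<lambda>(s, t) \<ge> 2\<close> holds iff every cut contains two arcs, iff
  no single arc separates \<open>t\<close> from \<open>s\<close>.  Let \<open>k \<ge> 2\<close> be the maximum flow value and truncate the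
  capacities to \<open>c' = min c (k - 1)\<close>.  A cut that contains an arc of capacity at least \<open>k\<close>
  contains a second arc of positive capacity, so every cut still has \<open>c'\<close>-capacity at least \<open>k\<close>.  By
  max-flow min-cut there is a flow of value \<open>k\<close> in which every arc carries at most \<open>k - 1\<close>; hence no
  cut of its support consists of a single arc.

  The network thus admits the required flow iff no deletion of one arc separates \<open>t\<close> from \<open>s\<close>
  among the arcs of positive capacity.  That test is a composition of folds over lists, and a fold
  runs in polynomial time if its step function does and increases the size of the accumulator by a
  bounded amount only.
\<close>

subsection \<open>Flows and cuts\<close>

text \<open>The values are integers so that a change of either sign along an augmenting path can be
  added to a flow.\<close>

definition net_out :: "('a, 'b) pre_digraph \<Rightarrow> ('b \<Rightarrow> int) \<Rightarrow> 'a \<Rightarrow> int" where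
  "net_out D x v = (\<Sum>a \<in> out_arcs D v. x a) - (\<Sum>a \<in> in_arcs D v. x a)"

lemma flow_value_eq_net_out: "flow_value D s x = net_out D (\<lambda>a. int (x a)) s"
  by (simp add: flow_value_def net_out_def)

lemma st_flow_iff_net_out:
  "st_flow D s t c x \<longleftrightarrow>
     (\<forall>a \<in> arcs D. x a \<le> c a) \<and> (\<forall>v \<in> verts D - {s, t}. net_out D (\<lambda>a. int (x a)) v = 0)"
  unfolding st_flow_def net_out_def right_minus_eq of_nat_sum[symmetric] of_nat_eq_iff
  by (metis (no_types))

lemma net_out_add: "net_out D (\<lambda>a. x a + y a) v = net_out D x v + net_out D y v"
  by (simp add: net_out_def sum.distrib)

lemma net_out_diff: "net_out D (\<lambda>a. x a - y a) v = net_out D x v - net_out D y v"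
  by (simp add: net_out_def sum_subtractf)

lemma net_out_cong: "(\<And>a. a \<in> arcs D \<Longrightarrow> x a = y a) \<Longrightarrow> net_out D x v = net_out D y v"
  unfolding net_out_def by (intro arg_cong2[where f = minus] sum.cong) auto

text \<open>For a loop the two indicator terms cancel, just as a loop enters both sums of
  \<open>net_out\<close>, so loops need no separate case.\<close>

lemma (in fin_digraph) net_out_single:
  assumes "e \<in> arcs G"
  shows "net_out G (\<lambda>a. k * of_bool (a = e)) v
    = k * (of_bool (v = tail G e) - of_bool (v = head G e))"
proof -
  have "(\<Sum>a \<in> A. k * of_bool (a = e)) = k * of_bool (e \<in> A)" if "finite A" for A
    using that by (simp add: of_bool_def if_distrib[of "(*) k"] sum.delta cong: if_cong)
  from this[OF finite_out_arcs] this[OF finite_in_arcs] show ?thesis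
    using assms by (auto simp: net_out_def)
qed

context fin_digraph
begin

definition cut_out :: "'a set \<Rightarrow> 'b set" where
  "cut_out S = {a \<in> arcs G. tail G a \<in> S \<and> head G a \<notin> S}"

definition cut_in :: "'a set \<Rightarrow> 'b set" where
  "cut_in S = {a \<in> arcs G. tail G a \<notin> S \<and> head G a \<in> S}"

lemma finite_cut [simp, intro]: "finite (cut_out S)" "finite (cut_in S)"
  by (simp_all add: cut_out_def cut_in_def)

text \<open>An arc with both ends in \<open>S\<close> is counted once as leaving and once as
  entering; these contributions cancel and only the arcs across the boundary remain.\<close>

lemma sum_net_out:
  assumes "finite S"
  shows "(\<Sum>v \<in> S. net_out G x v) = (\<Sum>a \<in> cut_out S. x a) - (\<Sum>a \<in> cut_in S. x a)"
proof -
  let ?I = "{a \<in> arcs G. tail G a \<in> S \<and> head G a \<in> S}"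
  have "(\<Sum>v \<in> S. \<Sum>a \<in> out_arcs G v. x a) = sum x {a \<in> arcs G. tail G a \<in> S}"
    unfolding out_arcs_def using assms
    by (subst sum.group[of "{a \<in> arcs G. tail G a \<in> S}" S "tail G" x, symmetric])
      (auto intro!: sum.cong)
  also have "{a \<in> arcs G. tail G a \<in> S} = cut_out S \<union> ?I" by (auto simp: cut_out_def)
  also have "sum x \<dots> = sum x (cut_out S) + sum x ?I"
    by (rule sum.union_disjoint) (auto simp: cut_out_def)
  finally have out: "(\<Sum>v \<in> S. \<Sum>a \<in> out_arcs G v. x a) = sum x (cut_out S) + sum x ?I" .
  have "(\<Sum>v \<in> S. \<Sum>a \<in> in_arcs G v. x a) = sum x {a \<in> arcs G. head G a \<in> S}"
    unfolding in_arcs_def using assms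
    by (subst sum.group[of "{a \<in> arcs G. head G a \<in> S}" S "head G" x, symmetric])
      (auto intro!: sum.cong)
  also have "{a \<in> arcs G. head G a \<in> S} = cut_in S \<union> ?I" by (auto simp: cut_in_def)
  also have "sum x \<dots> = sum x (cut_in S) + sum x ?I"
    by (rule sum.union_disjoint) (auto simp: cut_in_def)
  finally show ?thesis using out by (simp add: net_out_def sum_subtractf)
qed

text \<open>By conservation every vertex of \<open>S\<close> other than \<open>s\<close> contributes
  zero to the sum of the net outflows over \<open>S\<close>.\<close>

lemma flow_value_eq_cut:
  assumes "st_flow G s t c x" "S \<subseteq> verts G" "s \<in> S" "t \<notin> S"
  shows "flow_value G s x = (\<Sum>a \<in> cut_out S. int (x a)) - (\<Sum>a \<in> cut_in S. int (x a))"
proof -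
  have fin: "finite S" using assms(2) finite_verts finite_subset by blast
  have "net_out G (\<lambda>a. int (x a)) v = 0" if "v \<in> S - {s}" for v
    using assms that by (auto simp: st_flow_iff_net_out)
  then have "(\<Sum>v \<in> S. net_out G (\<lambda>a. int (x a)) v) = flow_value G s x"
    by (simp add: flow_value_eq_net_out sum.remove[OF fin assms(3)])
  then show ?thesis using sum_net_out[OF fin] by simp
qed

text \<open>Discarding the backward flow gives the first bound, and the capacities then give the
  second. The first serves arguments about the support of a flow.\<close>

lemma flow_value_le_cut:
  assumes "st_flow G s t c x" "S \<subseteq> verts G" "s \<in> S" "t \<notin> S"
  shows "flow_value G s x \<le> (\<Sum>a \<in> cut_out S. int (x a))"
    and "flow_value G s x \<le> int (\<Sum>a \<in> cut_out S. c a)"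
proof -
  have "0 \<le> (\<Sum>a \<in> cut_in S. int (x a))" by (simp add: sum_nonneg)
  then show 1: "flow_value G s x \<le> (\<Sum>a \<in> cut_out S. int (x a))"
    using flow_value_eq_cut[OF assms] by simp
  have "(\<Sum>a \<in> cut_out S. int (x a)) \<le> int (\<Sum>a \<in> cut_out S. c a)"
    using assms(1) by (auto simp: st_flow_def cut_out_def intro!: sum_mono)
  with 1 show "flow_value G s x \<le> int (\<Sum>a \<in> cut_out S. c a)" by linarith
qed

end

section \<open>Augmenting paths and max-flow min-cut\<close>

lemma (in wf_digraph) reachable_imp_apath:
  assumes "(u, v) \<in> (arcs_ends G)\<^sup>*" "u \<in> verts G"
  shows "\<exists>p. apath u p v"
proof -
  from assms have "\<exists>p. awalk u p v"
  proof (induction rule: converse_rtrancl_induct)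
    case base
    then show ?case by (auto intro: exI[of _ "[]"] simp: awalk_Nil_iff)
  next
    case (step y z)
    then obtain e where e: "e \<in> arcs G" "y = tail G e" "z = head G e"
      by (auto simp: arcs_ends_def arc_to_ends_def)
    with step obtain p where "awalk z p v" by auto
    with e have "awalk y (e # p) v" by (simp add: awalk_Cons_iff)
    then show ?case by blast
  qed
  then show ?thesis by (meson apath_awalk_to_apath)
qed

lemma (in pre_digraph) apath_distinct: "apath u p v \<Longrightarrow> distinct p"
  by (auto simp: apath_def awalk_verts_conv distinct_map split: if_splits)

text \<open>A pair \<open>(a, True)\<close> stands for the arc \<open>a\<close> traversed forwards, \<open>(a, False)\<close> for \<open>a\<close>
  traversed backwards.\<close>

definition signed_ends :: "('a, 'b) pre_digraph \<Rightarrow> 'b \<times> bool \<Rightarrow> 'a \<times> 'a" where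
  "signed_ends G e = (if snd e then (tail G (fst e), head G (fst e)) else (head G (fst e), tail G (fst e)))"

text \<open>The signed indicator of a path of signed arcs is the function sought: forward steps
  count 1, backward steps -1. An arc used in both directions gets 0, which respects both
  bounds.\<close>

lemma (in fin_digraph) unit_flow_of_reachable:
  assumes reach: "(u, v) \<in> (signed_ends G ` B)\<^sup>*" and B: "fst ` B \<subseteq> arcs G"
  shows "\<exists>d. (\<forall>w. net_out G d w = of_bool (w = u) - of_bool (w = v)) \<and>
             (\<forall>a. - of_bool ((a, False) \<in> B) \<le> d a \<and> d a \<le> of_bool ((a, True) \<in> B))"
proof -
  \<comment> \<open>\<open>R\<close> is the digraph of the signed arcs in \<open>B\<close>; taking
    the whole type as its vertices makes it well-formed at once.\<close>
  define R where "R = \<lparr>verts = UNIV, arcs = B, tail = fst \<circ> signed_ends G, head = snd \<circ> signed_ends G\<rparr>"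
  interpret R: wf_digraph R by unfold_locales (simp_all add: R_def)
  have "arcs_ends R = signed_ends G ` B"
    by (auto simp: arcs_ends_def arc_to_ends_def R_def)
  with reach R.reachable_imp_apath[of u v] obtain p where p: "R.apath u p v"
    by (auto simp: R_def)
  define d where "d p a = (of_bool ((a, True) \<in> set p) - of_bool ((a, False) \<in> set p) :: int)" for p :: "('b \<times> bool) list" and a
  have net: "net_out G (d p) w = of_bool (w = u) - of_bool (w = v)"
    if "R.awalk u p v" "distinct p" for w u p using that
  proof (induction p arbitrary: u)
    case Nil
    then show ?case by (simp add: d_def net_out_def R.awalk_Nil_iff)
  next
    case (Cons e p)
    let ?k = "if snd e then 1 else - 1 :: int"
    have e: "e \<in> B" "u = fst (signed_ends G e)" "R.awalk (snd (signed_ends G e)) p v" "e \<notin> set p"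
      using Cons.prems unfolding R.awalk_Cons_iff by (auto simp: R_def)
    \<comment> \<open>This needs that \<open>e\<close> does not recur in \<open>p\<close>; otherwise
      its sign would be counted twice on the right.\<close>
    have "d (e # p) a = ?k * of_bool (a = fst e) + d p a" for a
      using e(4) by (cases e) (auto simp: d_def)
    then have "net_out G (d (e # p)) w = net_out G (\<lambda>a. ?k * of_bool (a = fst e)) w + net_out G (d p) w"
      by (subst net_out_add[symmetric]) (auto intro: net_out_cong)
    moreover have "fst e \<in> arcs G" using e(1) B by auto
    ultimately show ?case
      using Cons.IH[OF e(3)] Cons.prems e(2)
      by (subst (asm) net_out_single) (auto simp: signed_ends_def)
  qed
  have "set p \<subseteq> arcs R" using p by (simp add: R.apath_def R.awalk_def)
  then have "- of_bool ((a, False) \<in> B) \<le> d p a \<and> d p a \<le> of_bool ((a, True) \<in> B)" for a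
    by (auto simp: d_def of_bool_def R_def)
  with net p R.apath_distinct[OF p] show ?thesis by (metis R.apath_def)
qed

context fin_digraph
begin

lemma reachable_in_verts:
  assumes "(s, v) \<in> (arc_to_ends G ` B)\<^sup>*" "s \<in> verts G" "B \<subseteq> arcs G"
  shows "v \<in> verts G"
  using assms by (induction rule: rtrancl_induct) (auto simp: arc_to_ends_def)

text \<open>Some residual path leads from \<open>s\<close> to \<open>t\<close>, since otherwise the
  vertices reachable from \<open>s\<close> would form a cut whose capacity equals the flow value.
  One unit is pushed along that path.\<close>

lemma augment_flow:
  assumes "s \<noteq> t" "s \<in> verts G"
    and cut: "\<And>S. S \<subseteq> verts G \<Longrightarrow> s \<in> S \<Longrightarrow> t \<notin> S \<Longrightarrow> flow_value G s x < int (\<Sum>a \<in> cut_out S. c a)"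
    and x: "st_flow G s t c x"
  shows "\<exists>y. st_flow G s t c y \<and> flow_value G s y = flow_value G s x + 1"
proof -
  \<comment> \<open>The residual arcs: forward where capacity is left, backward where flow can be
    withdrawn.\<close>
  define B where "B = {(a, True) | a. a \<in> arcs G \<and> x a < c a} \<union> {(a, False) | a. a \<in> arcs G \<and> 0 < x a}"
  define S where "S = {v. (s, v) \<in> (signed_ends G ` B)\<^sup>*}"
  have S_step: "snd (signed_ends G e) \<in> S" if "e \<in> B" "fst (signed_ends G e) \<in> S" for e
    using that unfolding S_def by (auto intro: rtrancl_into_rtrancl)
  have "v \<in> verts G" if "(s, v) \<in> (signed_ends G ` B)\<^sup>*" for v
    using that assms(2) by (induction rule: rtrancl_induct) (auto simp: signed_ends_def B_def)
  then have "S \<subseteq> verts G" by (auto simp: S_def)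
  moreover have "s \<in> S" by (simp add: S_def)
  \<comment> \<open>Since \<open>S\<close> is closed under residual steps, its outgoing arcs are
    saturated and its incoming arcs are empty.\<close>
  moreover have "flow_value G s x = int (\<Sum>a \<in> cut_out S. c a)" if "S \<subseteq> verts G" "t \<notin> S"
  proof -
    have "x a = c a" if "a \<in> cut_out S" for a
      using that S_step[of "(a, True)"] x
      by (auto simp: cut_out_def B_def signed_ends_def st_flow_def le_less)
    moreover have "x a = 0" if "a \<in> cut_in S" for a
      using that S_step[of "(a, False)"] by (auto simp: cut_in_def B_def signed_ends_def)
    ultimately show ?thesis
      using flow_value_eq_cut[OF x that(1) \<open>s \<in> S\<close> that(2)] by simp
  qed
  ultimately have "(s, t) \<in> (signed_ends G ` B)\<^sup>*" using cut[of S] by (auto simp: S_def)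
  moreover have "fst ` B \<subseteq> arcs G" by (auto simp: B_def)
  ultimately obtain d where
    d: "\<And>w. net_out G d w = of_bool (w = s) - of_bool (w = t)" and
    bounds: "\<And>a. - of_bool ((a, False) \<in> B) \<le> d a" "\<And>a. d a \<le> of_bool ((a, True) \<in> B)"
    using unit_flow_of_reachable[of s t B] by metis
  \<comment> \<open>On arcs \<open>nat\<close> truncates nothing, because \<open>d\<close> is
    negative only where \<open>x\<close> is positive.\<close>
  define y where "y a = nat (int (x a) + d a)" for a
  have y: "int (y a) = int (x a) + d a" "y a \<le> c a" if "a \<in> arcs G" for a
    using bounds[of a] x that unfolding y_def B_def st_flow_def
    by (auto simp: of_bool_def split: if_splits)
  have net: "net_out G (\<lambda>a. int (y a)) v = net_out G (\<lambda>a. int (x a)) v + of_bool (v = s) - of_bool (v = t)" for v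
    using net_out_cong[of G "\<lambda>a. int (y a)" "\<lambda>a. int (x a) + d a" v] y(1)
    by (simp add: net_out_add d)
  then have "st_flow G s t c y" using x y(2) by (auto simp: st_flow_iff_net_out)
  moreover have "flow_value G s y = flow_value G s x + 1"
    using net assms(1) by (simp add: flow_value_eq_net_out)
  ultimately show ?thesis by blast
qed

text \<open>This is the harder half of max-flow min-cut: starting from the zero flow, each
  augmentation raises the value by exactly one.\<close>

lemma flow_of_value:
  assumes "s \<noteq> t" "s \<in> verts G"
    and cut: "\<And>S. S \<subseteq> verts G \<Longrightarrow> s \<in> S \<Longrightarrow> t \<notin> S \<Longrightarrow> k \<le> (\<Sum>a \<in> cut_out S. c a)"
  shows "\<exists>x. st_flow G s t c x \<and> flow_value G s x = int k"
  using cut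
proof (induction k)
  case 0
  have "st_flow G s t c (\<lambda>_. 0)" "flow_value G s (\<lambda>_. 0) = 0"
    by (auto simp: st_flow_def flow_value_def)
  then show ?case by auto
next
  case (Suc k)
  from Suc.IH Suc.prems obtain x where x: "st_flow G s t c x" "flow_value G s x = int k"
    by (meson Suc_leD)
  have "flow_value G s x < int (\<Sum>a \<in> cut_out S. c a)" if "S \<subseteq> verts G" "s \<in> S" "t \<notin> S" for S
    using Suc.prems[OF that] x(2) by linarith
  from augment_flow[OF assms(1,2) this x(1)] x(2) show ?case by force
qed

text \<open>The cut around \<open>s\<close> bounds all flow values and the zero flow has value 0, so
  there is a greatest natural number among the values attained.\<close>

lemma maximum_flow_exists:
  assumes "s \<in> verts G" "s \<noteq> t"
  shows "\<exists>x. maximum_st_flow G s t c x"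
proof -
  have 0: "st_flow G s t c (\<lambda>_. 0)" "flow_value G s (\<lambda>_. 0) = 0"
    by (auto simp: st_flow_def flow_value_def)
  have le: "flow_value G s x \<le> int (\<Sum>a \<in> cut_out {s}. c a)" if "st_flow G s t c x" for x
    using flow_value_le_cut(2)[OF that, of "{s}"] assms by auto
  define P where "P n \<longleftrightarrow> (\<exists>x. st_flow G s t c x \<and> flow_value G s x = int n)" for n
  have "P 0" using 0 by (auto simp: P_def)
  moreover have "\<forall>n. P n \<longrightarrow> n \<le> (\<Sum>a \<in> cut_out {s}. c a)" using le by (fastforce simp: P_def simp flip: of_nat_sum)
  ultimately obtain n where n: "P n" "\<And>m. P m \<Longrightarrow> m \<le> n"
    using GreatestI_nat[of P] Greatest_le_nat[of P] by metis
  then obtain x where x: "st_flow G s t c x" "flow_value G s x = int n" by (auto simp: P_def)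
  \<comment> \<open>A value is negative when more flow enters \<open>s\<close> than leaves it; such
    a value lies below the natural number \<open>n\<close>.\<close>
  have "flow_value G s y \<le> flow_value G s x" if "st_flow G s t c y" for y
  proof (cases "flow_value G s y \<ge> 0")
    case True
    then have "P (nat (flow_value G s y))" using that by (auto simp: P_def)
    from n(2)[OF this] show ?thesis using x by linarith
  qed (use x in linarith)
  with x show ?thesis by (auto simp: maximum_st_flow_def)
qed

end

section \<open>Menger's theorem for two arc-disjoint paths\<close>

definition bridgeless :: "('a, 'b) pre_digraph \<Rightarrow> 'a \<Rightarrow> 'a \<Rightarrow> bool" where
  "bridgeless H s t \<longleftrightarrow> (\<forall>f. (s, t) \<in> (arc_to_ends H ` (arcs H - {f}))\<^sup>*)"

text \<open>Deleting the only arc of \<open>A\<close> in a cut closes it off. Conversely, the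
  vertices still reachable after deleting \<open>f\<close> form a set that \<open>A\<close> can
  leave only through \<open>f\<close>. Varying \<open>A\<close> covers every support digraph with
  the cuts of the one digraph \<open>G\<close>.\<close>

lemma (in fin_digraph) bridgeless_iff_cuts:
  assumes "s \<in> verts G" "A \<subseteq> arcs G"
  shows "bridgeless (G\<lparr>arcs := A\<rparr>) s t \<longleftrightarrow>
    (\<forall>S. S \<subseteq> verts G \<longrightarrow> s \<in> S \<longrightarrow> t \<notin> S \<longrightarrow> 2 \<le> card (cut_out S \<inter> A))"
proof (intro iffI allI impI)
  fix S assume br: "bridgeless (G\<lparr>arcs := A\<rparr>) s t" and S: "S \<subseteq> verts G" "s \<in> S" "t \<notin> S"
  \<comment> \<open>Used twice: for a first arc of the cut, then for one different from it.\<close>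
  have cross: "\<exists>a. a \<in> cut_out S \<inter> A \<and> a \<noteq> f" for f
  proof (rule ccontr)
    assume no: "\<nexists>a. a \<in> cut_out S \<inter> A \<and> a \<noteq> f"
    have "(s, t) \<in> (arc_to_ends G ` (A - {f}))\<^sup>*"
      using br by (simp add: bridgeless_def arc_to_ends_def)
    then have "t \<in> S"
    proof (induction rule: rtrancl_induct)
      case (step y z)
      then show ?case using no assms(2) by (auto simp: arc_to_ends_def cut_out_def)
    qed (use S in auto)
    with S show False by simp
  qed
  obtain a where a: "a \<in> cut_out S \<inter> A" using cross by blast
  obtain b where b: "b \<in> cut_out S \<inter> A" "b \<noteq> a" using cross by blast
  have "card {a, b} \<le> card (cut_out S \<inter> A)" using a b by (intro card_mono) auto
  then show "2 \<le> card (cut_out S \<inter> A)" using b by simp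
next
  assume cuts: "\<forall>S. S \<subseteq> verts G \<longrightarrow> s \<in> S \<longrightarrow> t \<notin> S \<longrightarrow> 2 \<le> card (cut_out S \<inter> A)"
  have "(s, t) \<in> (arc_to_ends G ` (A - {f}))\<^sup>*" for f
  proof (rule ccontr)
    let ?S = "{v. (s, v) \<in> (arc_to_ends G ` (A - {f}))\<^sup>*}"
    assume "(s, t) \<notin> (arc_to_ends G ` (A - {f}))\<^sup>*"
    moreover have "?S \<subseteq> verts G" using reachable_in_verts[of s _ "A - {f}"] assms by auto
    moreover have "cut_out ?S \<inter> A \<subseteq> {f}"
    proof (intro subsetI, rule ccontr)
      fix a assume a: "a \<in> cut_out ?S \<inter> A" "a \<notin> {f}"
      then have "(tail G a, head G a) \<in> arc_to_ends G ` (A - {f})"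
        by (auto simp: arc_to_ends_def)
      with a show False by (auto simp: cut_out_def dest: rtrancl_into_rtrancl)
    qed
    then have "card (cut_out ?S \<inter> A) \<le> 1" using card_mono[of "{f}" "cut_out ?S \<inter> A"] by simp
    moreover have "s \<in> ?S" by simp
    ultimately have "2 \<le> card (cut_out ?S \<inter> A)" using cuts by blast
    with \<open>card (cut_out ?S \<inter> A) \<le> 1\<close> show False by linarith
  qed
  then show "bridgeless (G\<lparr>arcs := A\<rparr>) s t" by (simp add: bridgeless_def arc_to_ends_def)
qed

lemma cas_arcs_update [simp]:
  "pre_digraph.cas (G\<lparr>arcs := A\<rparr>) u p v = pre_digraph.cas G u p v"
  by (induction p arbitrary: u) (simp_all add: pre_digraph.cas.simps)

lemma awalk_verts_arcs_update [simp]: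
  "pre_digraph.awalk_verts (G\<lparr>arcs := A\<rparr>) u p = pre_digraph.awalk_verts G u p"
  by (induction p arbitrary: u) (simp_all add: pre_digraph.awalk_verts.simps)

lemma apath_arcs_update:
  assumes "A \<subseteq> arcs G"
  shows "pre_digraph.apath (G\<lparr>arcs := A\<rparr>) u p v \<longleftrightarrow> pre_digraph.apath G u p v \<and> set p \<subseteq> A"
  using assms by (auto simp: pre_digraph.apath_def pre_digraph.awalk_def)

lemma (in fin_digraph) fin_digraph_arcs_update:
  "A \<subseteq> arcs G \<Longrightarrow> fin_digraph (G\<lparr>arcs := A\<rparr>)"
  by unfold_locales (auto intro: finite_subset)

lemma (in fin_digraph) fin_digraph_support: "fin_digraph (support_digraph G x)"
  unfolding support_digraph_def by (rule fin_digraph_arcs_update) auto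

text \<open>The relation uses only the arcs of the walk itself, so a walk avoiding \<open>f\<close>
  yields reachability after \<open>f\<close> is deleted.\<close>

lemma (in wf_digraph) awalk_imp_reachable:
  "awalk u p v \<Longrightarrow> (u, v) \<in> (arc_to_ends G ` set p)\<^sup>*"
proof (induction p arbitrary: u)
  case (Cons e p)
  then have "(u, head G e) \<in> arc_to_ends G ` set (e # p)" "(head G e, v) \<in> (arc_to_ends G ` set p)\<^sup>*"
    by (auto simp: awalk_Cons_iff arc_to_ends_def)
  moreover have "(arc_to_ends G ` set p)\<^sup>* \<subseteq> (arc_to_ends G ` set (e # p))\<^sup>*"
    by (intro rtrancl_mono) auto
  ultimately show ?case by (meson converse_rtrancl_into_rtrancl subsetD)
qed (simp add: awalk_Nil_iff)

text \<open>The contributions of consecutive arcs telescope, so such a walk is a unit flow;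
  subtracting it peels a path off a flow.\<close>

lemma (in fin_digraph) net_out_awalk:
  "awalk u p v \<Longrightarrow> distinct p \<Longrightarrow>
    net_out G (\<lambda>a. of_bool (a \<in> set p)) w = of_bool (w = u) - of_bool (w = v)"
proof (induction p arbitrary: u)
  case Nil
  then show ?case by (simp add: net_out_def awalk_Nil_iff)
next
  case (Cons e p)
  have "net_out G (\<lambda>a. of_bool (a \<in> set (e # p))) w
      = net_out G (\<lambda>a. 1 * of_bool (a = e) + of_bool (a \<in> set p)) w"
    using Cons.prems by (intro net_out_cong) auto
  also have "\<dots> = net_out G (\<lambda>a. 1 * of_bool (a = e)) w + net_out G (\<lambda>a. of_bool (a \<in> set p)) w"
    by (rule net_out_add)
  finally show ?case
    using Cons by (subst (asm) net_out_single) (auto simp: awalk_Cons_iff)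
qed

context fin_digraph
begin

text \<open>If \<open>t\<close> were unreachable in the support, no flow would leave the set of
  vertices reachable from \<open>s\<close>, against the positive value.\<close>

lemma flow_value_pos_imp_apath:
  assumes x: "st_flow G s t c x" "flow_value G s x > 0" and "s \<in> verts G"
  shows "\<exists>p. apath s p t \<and> (\<forall>a \<in> set p. 0 < x a)"
proof -
  let ?A = "{a \<in> arcs G. 0 < x a}"
  let ?S = "{v. (s, v) \<in> (arc_to_ends G ` ?A)\<^sup>*}"
  have "t \<in> ?S"
  proof (rule ccontr)
    assume "t \<notin> ?S"
    moreover have "?S \<subseteq> verts G" using reachable_in_verts[of s _ ?A] assms by auto
    ultimately have "0 < (\<Sum>a \<in> cut_out ?S. int (x a))"
      using flow_value_le_cut(1)[OF x(1), of ?S] x(2) by simp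
    then obtain a where a: "a \<in> cut_out ?S" "0 < int (x a)"
      by (metis (no_types, lifting) not_less sum_nonpos)
    then have "(tail G a, head G a) \<in> arc_to_ends G ` ?A"
      by (auto simp: arc_to_ends_def cut_out_def)
    with a show False by (auto simp: cut_out_def dest: rtrancl_into_rtrancl)
  qed
  moreover interpret H: fin_digraph "G\<lparr>arcs := ?A\<rparr>" by (rule fin_digraph_arcs_update) auto
  have "arcs_ends (G\<lparr>arcs := ?A\<rparr>) = arc_to_ends G ` ?A"
    by (auto simp: arcs_ends_def arc_to_ends_def)
  ultimately obtain p where "H.apath s p t"
    using H.reachable_imp_apath[of s t] assms(3) by auto
  then show ?thesis by (subst (asm) apath_arcs_update) auto
qed

text \<open>With unit capacities, two arcs in every cut give a flow of value 2. Removing one path of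
  its support leaves a flow of value 1, whose support contains the second path.\<close>

lemma bridgeless_imp_disjoint_paths:
  assumes br: "bridgeless G s t" and "s \<noteq> t" "s \<in> verts G"
  shows "\<exists>p q. apath s p t \<and> apath s q t \<and> set p \<inter> set q = {}"
proof -
  have "2 \<le> (\<Sum>a \<in> cut_out S. 1 :: nat)" if "S \<subseteq> verts G" "s \<in> S" "t \<notin> S" for S
  proof -
    have "cut_out S \<inter> arcs G = cut_out S" by (auto simp: cut_out_def)
    then have "2 \<le> card (cut_out S)"
      using bridgeless_iff_cuts[of s "arcs G" t] assms that by (simp (no_asm_use)) metis
    then show ?thesis by simp
  qed
  from flow_of_value[OF assms(2,3) this] obtain x where
    x: "st_flow G s t (\<lambda>_. 1) x" "flow_value G s x = 2" by auto
  then obtain p where p: "apath s p t" "\<forall>a \<in> set p. 0 < x a"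
    using flow_value_pos_imp_apath[OF x(1)] assms by auto
  \<comment> \<open>The subtraction of natural numbers is exact because \<open>x\<close> is positive
    on \<open>p\<close>.\<close>
  define y where "y a = x a - of_bool (a \<in> set p)" for a
  have "net_out G (\<lambda>a. int (y a)) v = net_out G (\<lambda>a. int (x a) - of_bool (a \<in> set p)) v" for v
    using p(2) by (intro net_out_cong) (auto simp: y_def of_nat_diff)
  then have net: "net_out G (\<lambda>a. int (y a)) v
      = net_out G (\<lambda>a. int (x a)) v - (of_bool (v = s) - of_bool (v = t))" for v
    using net_out_awalk[of s p t v] p(1) apath_distinct[OF p(1)]
    by (simp add: net_out_diff apath_def)
  have "y a \<le> 1" if "a \<in> arcs G" for a
    using x(1) that by (auto simp: y_def st_flow_def intro: le_trans[OF diff_le_self])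
  with net x(1) have "st_flow G s t (\<lambda>_. 1) y" by (auto simp: st_flow_iff_net_out)
  moreover have "flow_value G s y = 1"
    using net x(2) assms(2) by (simp add: flow_value_eq_net_out)
  ultimately obtain q where q: "apath s q t" "\<forall>a \<in> set q. 0 < y a"
    using flow_value_pos_imp_apath[of s t "\<lambda>_. 1" y] assms by auto
  have "False" if "a \<in> set p" "a \<in> set q" for a
  proof -
    \<comment> \<open>An arc of \<open>p\<close> has \<open>x a = 1\<close>, hence
      \<open>y a = 0\<close>, so \<open>q\<close> cannot use it.\<close>
    have "0 < y a" "x a \<le> 1" using q that(2) x(1) by (auto simp: apath_def awalk_def st_flow_def)
    then show False using that(1) by (simp add: y_def)
  qed
  with p q show ?thesis by blast
qed

text \<open>An arc \<open>f\<close> lies on at most one of the two paths; the other survives its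
  deletion.\<close>

lemma disjoint_paths_imp_bridgeless:
  assumes "apath s p t" "apath s q t" "set p \<inter> set q = {}"
  shows "bridgeless G s t"
  unfolding bridgeless_def
proof
  fix f
  obtain r where r: "awalk s r t" "f \<notin> set r"
    using assms by (metis apath_def disjoint_iff)
  then have "arc_to_ends G ` set r \<subseteq> arc_to_ends G ` (arcs G - {f})"
    by (auto simp: awalk_def)
  then show "(s, t) \<in> (arc_to_ends G ` (arcs G - {f}))\<^sup>*"
    using awalk_imp_reachable[OF r(1)] rtrancl_mono by blast
qed

lemma local_arc_connectivity_ge_2_iff_paths:
  assumes "s \<noteq> t"
  shows "2 \<le> local_arc_connectivity G s t \<longleftrightarrow>
    (\<exists>p q. apath s p t \<and> apath s q t \<and> set p \<inter> set q = {})"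
proof -
  let ?C = "{card P | P. arc_disjoint_paths G s t P}"
  \<comment> \<open>\<open>Max\<close> is meaningful for finite nonempty sets: there are finitely
    many paths, and the empty family contributes 0.\<close>
  have "finite {p. apath s p t}" by (rule finite_subset[OF _ finite_imageI[OF apaths_finite_triple, of "\<lambda>(u, p, v). p"]]) force
  then have "finite {P. arc_disjoint_paths G s t P}"
    by (intro finite_subset[OF _ finite_Pow_iff[THEN iffD2]]) (auto simp: arc_disjoint_paths_def)
  then have fin: "finite ?C" by simp
  have "0 \<in> ?C" by (auto simp: arc_disjoint_paths_def intro!: exI[of _ "{}"])
  then have "2 \<le> local_arc_connectivity G s t \<longleftrightarrow> (\<exists>P. arc_disjoint_paths G s t P \<and> 2 \<le> card P)"
    unfolding local_arc_connectivity_def using fin by (subst Max_ge_iff) auto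
  also have "\<dots> \<longleftrightarrow> (\<exists>p q. apath s p t \<and> apath s q t \<and> set p \<inter> set q = {})"
  proof
    assume "\<exists>P. arc_disjoint_paths G s t P \<and> 2 \<le> card P"
    then obtain P where P: "arc_disjoint_paths G s t P" "2 \<le> card P" by blast
    then have "finite P" "\<not> card P \<le> Suc 0" by (auto intro: card_ge_0_finite)
    then obtain p q where "p \<in> P" "q \<in> P" "p \<noteq> q" by (auto simp: card_le_Suc0_iff_eq)
    with P(1) show "\<exists>p q. apath s p t \<and> apath s q t \<and> set p \<inter> set q = {}"
      by (meson arc_disjoint_paths_def)
  next
    assume "\<exists>p q. apath s p t \<and> apath s q t \<and> set p \<inter> set q = {}"
    then obtain p q where pq: "apath s p t" "apath s q t" "set p \<inter> set q = {}" by blast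
    \<comment> \<open>As \<open>s\<close> and \<open>t\<close> differ, neither path is empty, so
      disjointness forces them to be distinct.\<close>
    then have "p \<noteq> q" using assms by (auto simp: apath_Nil_iff)
    with pq show "\<exists>P. arc_disjoint_paths G s t P \<and> 2 \<le> card P"
      by (intro exI[of _ "{p, q}"]) (auto simp: arc_disjoint_paths_def)
  qed
  finally show ?thesis .
qed

lemma local_arc_connectivity_ge_2_iff_bridgeless:
  assumes "s \<noteq> t" "s \<in> verts G"
  shows "2 \<le> local_arc_connectivity G s t \<longleftrightarrow> bridgeless G s t"
  using local_arc_connectivity_ge_2_iff_paths bridgeless_imp_disjoint_paths
    disjoint_paths_imp_bridgeless assms by metis

section \<open>Maximum flows whose support has no single-arc cut\<close>

lemma bridgeless_maximum_flow:
  assumes "s \<noteq> t" "s \<in> verts G" and br: "bridgeless (support_digraph G c) s t"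
  shows "\<exists>x. maximum_st_flow G s t c x \<and> bridgeless (support_digraph G x) s t"
proof -
  let ?A = "{a \<in> arcs G. 0 < c a}"
  obtain z where z: "maximum_st_flow G s t c z" using maximum_flow_exists assms by blast
  define k where "k = nat (flow_value G s z)"
  have cuts: "2 \<le> card (cut_out S \<inter> ?A)" if "S \<subseteq> verts G" "s \<in> S" "t \<notin> S" for S
    using br bridgeless_iff_cuts[of s ?A t] assms that by (simp add: support_digraph_def)
  have sum_ge: "card (cut_out S \<inter> ?A) \<le> (\<Sum>a \<in> cut_out S. c' a)"
    if "\<And>a. a \<in> ?A \<Longrightarrow> 1 \<le> c' a" for S and c' :: "'b \<Rightarrow> nat"
  proof -
    have "card (cut_out S \<inter> ?A) \<le> (\<Sum>a \<in> cut_out S \<inter> ?A. c' a)"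
      using sum_mono[of "cut_out S \<inter> ?A" "\<lambda>_. 1" c'] that by simp
    also have "\<dots> \<le> (\<Sum>a \<in> cut_out S. c' a)" by (intro sum_mono2) auto
    finally show ?thesis .
  qed
  \<comment> \<open>A flow of value 2 results, so \<open>k\<close> is at least 2 and the truncation
    bound \<open>k - 1\<close> is positive.\<close>
  have "2 \<le> (\<Sum>a \<in> cut_out S. c a)" if "S \<subseteq> verts G" "s \<in> S" "t \<notin> S" for S
    using cuts[OF that] sum_ge[of c S] by auto
  from flow_of_value[OF assms(1,2) this] obtain y where
    "st_flow G s t c y" "flow_value G s y = 2" by auto
  with z have k: "2 \<le> k" "flow_value G s z = int k"
    unfolding maximum_st_flow_def k_def by (metis nat_2 nat_mono numeral_2_eq_2, fastforce)
  define c' where "c' a = min (c a) (k - 1)" for a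
  have "k \<le> (\<Sum>a \<in> cut_out S. c' a)" if S: "S \<subseteq> verts G" "s \<in> S" "t \<notin> S" for S
  proof (cases "\<exists>a \<in> cut_out S. k \<le> c a")
    case True
    \<comment> \<open>After truncation \<open>a\<close> contributes \<open>k - 1\<close>, and a
      second arc \<open>b\<close> of positive capacity supplies the missing unit.\<close>
    then obtain a where a: "a \<in> cut_out S" "k \<le> c a" by blast
    then have "card (cut_out S \<inter> ?A - {a}) \<ge> 1"
      using cuts[OF S] k by (subst card_Diff_singleton) (auto simp: cut_out_def)
    then have "cut_out S \<inter> ?A - {a} \<noteq> {}" by force
    then obtain b where b: "b \<in> cut_out S" "0 < c b" "b \<noteq> a" by blast
    have "k \<le> c' a + c' b" using a b k by (auto simp: c'_def min_def)
    also have "\<dots> = (\<Sum>e \<in> {a, b}. c' e)" using b by simp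
    also have "\<dots> \<le> (\<Sum>e \<in> cut_out S. c' e)" using a b by (intro sum_mono2) auto
    finally show ?thesis .
  next
    case False
    \<comment> \<open>No arc of this cut is truncated, and the flow \<open>z\<close> of value
      \<open>k\<close> passes through it.\<close>
    then have "(\<Sum>a \<in> cut_out S. c' a) = (\<Sum>a \<in> cut_out S. c a)"
      by (intro sum.cong) (auto simp: c'_def min_def)
    moreover have "int k \<le> int (\<Sum>a \<in> cut_out S. c a)"
      using flow_value_le_cut(2)[of s t c z S] z k S by (simp add: maximum_st_flow_def)
    ultimately show ?thesis by (simp only: of_nat_le_iff)
  qed
  from flow_of_value[OF assms(1,2) this] obtain x where
    x: "st_flow G s t c' x" "flow_value G s x = int k" by auto
  have "maximum_st_flow G s t c x"
    using x z k by (auto simp: maximum_st_flow_def st_flow_def c'_def)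
  moreover have "2 \<le> card (cut_out S \<inter> {a \<in> arcs G. 0 < x a})" (is "_ \<le> card ?B")
    if S: "S \<subseteq> verts G" "s \<in> S" "t \<notin> S" for S
  proof (rule ccontr)
    assume "\<not> 2 \<le> card ?B"
    \<comment> \<open>At most one arc would have to carry all \<open>k\<close> units across the cut,
      but \<open>c'\<close> allows it only \<open>k - 1\<close>.\<close>
    have "int k \<le> (\<Sum>a \<in> cut_out S. int (x a))"
      using flow_value_le_cut(1)[OF x(1) S] x(2) by simp
    also have "\<dots> = (\<Sum>a \<in> ?B. int (x a))"
      by (rule sum.mono_neutral_right) (auto simp: cut_out_def)
    also have "\<dots> \<le> int (card ?B) * int (k - 1)"
      using x(1) by (intro sum_bounded_above) (auto simp: st_flow_def c'_def)
    also have "\<dots> \<le> 1 * int (k - 1)"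
      using \<open>\<not> 2 \<le> card ?B\<close> by (intro mult_right_mono) auto
    finally show False using k by simp
  qed
  then have "bridgeless (support_digraph G x) s t"
    using bridgeless_iff_cuts[of s "{a \<in> arcs G. 0 < x a}" t] assms
    by (simp add: support_digraph_def)
  ultimately show ?thesis by blast
qed

text \<open>A flow is supported on arcs of positive capacity, which gives one direction; truncated
  capacities give the other. The question about maximum flows thus becomes one about
  reachability.\<close>

lemma maximum_flow_connectivity_iff:
  assumes "s \<noteq> t" "s \<in> verts G"
  shows "(\<exists>x. maximum_st_flow G s t c x \<and> 2 \<le> local_arc_connectivity (support_digraph G x) s t)
    \<longleftrightarrow> bridgeless (support_digraph G c) s t"
proof -
  have eq: "2 \<le> local_arc_connectivity (support_digraph G x) s t
      \<longleftrightarrow> bridgeless (support_digraph G x) s t" for x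
    using fin_digraph.local_arc_connectivity_ge_2_iff_bridgeless[OF fin_digraph_support] assms
    by (simp add: support_digraph_def)
  have "bridgeless (support_digraph G c) s t"
    if "maximum_st_flow G s t c x" "bridgeless (support_digraph G x) s t" for x
  proof -
    have "(arc_to_ends G ` ({a \<in> arcs G. 0 < x a} - {f}))\<^sup>*
        \<subseteq> (arc_to_ends G ` ({a \<in> arcs G. 0 < c a} - {f}))\<^sup>*" for f
      using that(1) by (intro rtrancl_mono image_mono) (fastforce simp: maximum_st_flow_def st_flow_def)
    then show ?thesis
      using that(2) unfolding bridgeless_def support_digraph_def by (auto simp: arc_to_ends_def)
  qed
  with bridgeless_maximum_flow[OF assms] show ?thesis by (auto simp: eq)
qed

end

subsection \<open>Polynomial-time functions on trees\<close>

definition poly_bounded :: "(nat \<Rightarrow> nat) \<Rightarrow> bool" where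
  "poly_bounded f \<longleftrightarrow> (\<exists>q :: nat poly. \<forall>n. f n \<le> poly q n)"

text \<open>Each step of Horner's rule is monotone for natural coefficients. A bound on an
  intermediate size may therefore be substituted into a running time.\<close>

lemma poly_nat_mono: "m \<le> n \<Longrightarrow> poly (q :: nat poly) m \<le> poly q n"
proof (induction q)
  case (pCons a q)
  then have "m * poly q m \<le> n * poly q n" by (intro mult_le_mono)
  then show ?case by simp
qed simp

lemma poly_bounded_poly: "poly_bounded (\<lambda>n. poly q n)"
  unfolding poly_bounded_def by (rule exI[of _ q]) simp

lemma poly_bounded_const: "poly_bounded (\<lambda>_. k)"
  unfolding poly_bounded_def by (rule exI[of _ "[:k:]"]) simp

lemma poly_bounded_id: "poly_bounded (\<lambda>n. n)"
  unfolding poly_bounded_def by (rule exI[of _ "[:0, 1:]"]) simp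

lemma poly_bounded_add:
  "poly_bounded f \<Longrightarrow> poly_bounded g \<Longrightarrow> poly_bounded (\<lambda>n. f n + g n)"
proof -
  assume "poly_bounded f" "poly_bounded g"
  then obtain q r :: "nat poly" where "\<forall>n. f n \<le> poly q n" "\<forall>n. g n \<le> poly r n"
    unfolding poly_bounded_def by (elim exE)
  then have "\<forall>n. f n + g n \<le> poly (q + r) n" by (simp add: add_mono)
  then show ?thesis unfolding poly_bounded_def by (rule exI)
qed

lemma poly_bounded_mult:
  "poly_bounded f \<Longrightarrow> poly_bounded g \<Longrightarrow> poly_bounded (\<lambda>n. f n * g n)"
proof -
  assume "poly_bounded f" "poly_bounded g"
  then obtain q r :: "nat poly" where "\<forall>n. f n \<le> poly q n" "\<forall>n. g n \<le> poly r n"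
    unfolding poly_bounded_def by (elim exE)
  then have "\<forall>n. f n * g n \<le> poly (q * r) n" by (simp add: mult_le_mono)
  then show ?thesis unfolding poly_bounded_def by (rule exI)
qed

lemma poly_bounded_poly_comp:
  assumes "poly_bounded f" shows "poly_bounded (\<lambda>n. poly q (f n))"
proof -
  from assms obtain r :: "nat poly" where "\<forall>n. f n \<le> poly r n"
    unfolding poly_bounded_def by (elim exE)
  then have "\<forall>n. poly q (f n) \<le> poly (pcompose q r) n"
    by (simp add: poly_pcompose poly_nat_mono)
  then show ?thesis unfolding poly_bounded_def by (rule exI)
qed

lemmas poly_bounded_intros = poly_bounded_const poly_bounded_id poly_bounded_poly
  poly_bounded_add poly_bounded_mult poly_bounded_poly_comp

text \<open>Inside a larger program the scratch variables hold leftovers, so every initial state is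
  allowed; the variables from \<open>n\<close> on are preserved and can store values across a call.
  The output size is bounded separately, since one assignment can double a tree at constant
  cost.\<close>

definition computes :: "com \<Rightarrow> nat \<Rightarrow> (tree \<Rightarrow> tree) \<Rightarrow> (nat \<Rightarrow> nat) \<Rightarrow> bool" where
  "computes C n f T \<longleftrightarrow> (\<forall>\<sigma>. \<exists>k \<tau>. exec C \<sigma> k \<tau> \<and> \<tau> 0 = f (\<sigma> 0) \<and> (\<forall>i \<ge> n. \<tau> i = \<sigma> i) \<and>
     k \<le> T (size (\<sigma> 0)) \<and> size (f (\<sigma> 0)) \<le> T (size (\<sigma> 0)))"

definition poly_time_fun :: "(tree \<Rightarrow> tree) \<Rightarrow> bool" where
  "poly_time_fun f \<longleftrightarrow> (\<exists>C n. \<exists>q :: nat poly. computes C n f (poly q))"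

lemma computes_mono:
  assumes "computes C n f T" "n \<le> m" "\<And>k. T k \<le> T' k"
  shows "computes C m f T'"
  unfolding computes_def
proof
  fix \<sigma> :: state
  from assms(1) obtain k \<tau> where "exec C \<sigma> k \<tau>" "\<tau> 0 = f (\<sigma> 0)" "\<forall>i \<ge> n. \<tau> i = \<sigma> i"
    "k \<le> T (size (\<sigma> 0))" "size (f (\<sigma> 0)) \<le> T (size (\<sigma> 0))"
    unfolding computes_def by blast
  with assms(2) le_trans[OF _ assms(3)]
  show "\<exists>k \<tau>. exec C \<sigma> k \<tau> \<and> \<tau> 0 = f (\<sigma> 0) \<and> (\<forall>i \<ge> m. \<tau> i = \<sigma> i) \<and>
    k \<le> T' (size (\<sigma> 0)) \<and> size (f (\<sigma> 0)) \<le> T' (size (\<sigma> 0))"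
    by (intro exI[of _ k] exI[of _ \<tau>]) simp
qed

lemma poly_time_funI:
  assumes "computes C n f T" "poly_bounded T"
  shows "poly_time_fun f"
proof -
  from assms(2) obtain q :: "nat poly" where "\<forall>n. T n \<le> poly q n"
    unfolding poly_bounded_def by (elim exE)
  with computes_mono[OF assms(1) le_refl] show ?thesis unfolding poly_time_fun_def by metis
qed

text \<open>Any larger bound on the variables works as well, so two programs can be given a common
  one.\<close>

lemma poly_time_funE:
  assumes "poly_time_fun f"
  obtains C n q where "\<forall>m \<ge> n. computes C m f (poly (q :: nat poly))"
proof -
  from assms obtain C n q where "computes C n f (poly (q :: nat poly))"
    unfolding poly_time_fun_def by blast
  then have "\<forall>m \<ge> n. computes C m f (poly q)" using computes_mono[OF _ _ le_refl] by blast
  then show thesis by (rule that)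
qed

lemma computesD:
  assumes "computes C n f T"
  shows "\<exists>k \<tau>. exec C \<sigma> k \<tau> \<and> \<tau> 0 = f (\<sigma> 0) \<and> (\<forall>i \<ge> n. \<tau> i = \<sigma> i) \<and>
    k \<le> T (size (\<sigma> 0)) \<and> size (f (\<sigma> 0)) \<le> T (size (\<sigma> 0))"
  using assms unfolding computes_def by (rule spec)

lemma poly_time_decidableI:
  assumes "poly_time_fun f" "\<And>i. i \<in> I \<Longrightarrow> f (enc i) \<noteq> Atom \<longleftrightarrow> Q i"
  shows "poly_time_decidable enc I Q"
proof -
  from assms(1) obtain C n q where C: "computes C n f (poly (q :: nat poly))"
    unfolding poly_time_fun_def by blast
  have "\<exists>k \<tau>. exec C ((\<lambda>_. Atom)(0 := enc i)) k \<tau> \<and> k \<le> poly q (size (enc i)) \<and> (\<tau> 0 \<noteq> Atom \<longleftrightarrow> Q i)"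
    if "i \<in> I" for i
    using computesD[OF C, of "(\<lambda>_. Atom)(0 := enc i)"] assms(2)[OF that] by (metis fun_upd_same)
  then show ?thesis unfolding poly_time_decidable_def by blast
qed

section \<open>Closure properties of polynomial-time functions\<close>

lemma poly_time_fun_exp:
  assumes "\<And>\<sigma>. val e \<sigma> = f (\<sigma> 0)" "\<And>t. size (f t) \<le> size t"
  shows "poly_time_fun f"
proof (rule poly_time_funI)
  show "computes (Assign 0 e) 1 f (\<lambda>n. n + (1 + cost e))"
    unfolding computes_def
  proof
    fix \<sigma> :: state
    show "\<exists>k \<tau>. exec (Assign 0 e) \<sigma> k \<tau> \<and> \<tau> 0 = f (\<sigma> 0) \<and> (\<forall>i\<ge>1. \<tau> i = \<sigma> i) \<and>
      k \<le> size (\<sigma> 0) + (1 + cost e) \<and> size (f (\<sigma> 0)) \<le> size (\<sigma> 0) + (1 + cost e)"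
      using exec.Assign[of 0 e \<sigma>] assms(1)[of \<sigma>] assms(2)[of "\<sigma> 0"]
      by (intro exI[of _ "1 + cost e"] exI[of _ "\<sigma>(0 := val e \<sigma>)"]) auto
  qed
qed (intro poly_bounded_intros)

lemma size_left_le: "size (left t) \<le> size t" and size_right_le: "size (right t) \<le> size t"
  by (cases t; simp)+

lemma poly_time_id: "poly_time_fun (\<lambda>t. t)"
  by (rule poly_time_fun_exp[of "V 0"]) simp_all

lemma poly_time_Atom: "poly_time_fun (\<lambda>_. Atom)"
  by (rule poly_time_fun_exp[of AtomE]) simp_all

lemma poly_time_comp:
  assumes "poly_time_fun f" "poly_time_fun g"
  shows "poly_time_fun (\<lambda>t. g (f t))"
proof -
  obtain C n q where C: "\<forall>m \<ge> n. computes C m f (poly (q :: nat poly))"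
    using poly_time_funE[OF assms(1)] by metis
  obtain D n' r where D: "\<forall>m \<ge> n'. computes D m g (poly (r :: nat poly))"
    using poly_time_funE[OF assms(2)] by metis
  define m where "m = max n n'"
  have Cm: "computes C m f (poly q)" and Dm: "computes D m g (poly r)" using C D by (simp_all add: m_def)
  show ?thesis
  proof (rule poly_time_funI)
    show "computes (Seq C D) m (\<lambda>t. g (f t)) (\<lambda>k. poly q k + poly r (poly q k))"
      unfolding computes_def
    proof
      fix \<sigma> :: state
      obtain k \<sigma>' where C': "exec C \<sigma> k \<sigma>'" "\<sigma>' 0 = f (\<sigma> 0)" "\<forall>i \<ge> m. \<sigma>' i = \<sigma> i"
        "k \<le> poly q (size (\<sigma> 0))" "size (\<sigma>' 0) \<le> poly q (size (\<sigma> 0))"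
        using computesD[OF Cm, of \<sigma>] by auto
      obtain l \<tau> where D': "exec D \<sigma>' l \<tau>" "\<tau> 0 = g (\<sigma>' 0)" "\<forall>i \<ge> m. \<tau> i = \<sigma>' i"
        "l \<le> poly r (size (\<sigma>' 0))" "size (g (\<sigma>' 0)) \<le> poly r (size (\<sigma>' 0))"
        using computesD[OF Dm, of \<sigma>'] by auto
      show "\<exists>k \<tau>. exec (Seq C D) \<sigma> k \<tau> \<and> \<tau> 0 = g (f (\<sigma> 0)) \<and> (\<forall>i \<ge> m. \<tau> i = \<sigma> i) \<and>
        k \<le> poly q (size (\<sigma> 0)) + poly r (poly q (size (\<sigma> 0))) \<and>
        size (g (f (\<sigma> 0))) \<le> poly q (size (\<sigma> 0)) + poly r (poly q (size (\<sigma> 0)))"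
        using exec.Seq[OF C'(1) D'(1)] C' D' poly_nat_mono[OF C'(5), of r]
        by (intro exI[of _ "k + l"] exI[of _ \<tau>]) auto
    qed
  qed (intro poly_bounded_intros)
qed

lemma poly_time_left: "poly_time_fun f \<Longrightarrow> poly_time_fun (\<lambda>t. left (f t))"
  by (rule poly_time_comp[where g = left])
    (auto intro: poly_time_fun_exp[of "LeftE (V 0)" left] simp: size_left_le)

lemma poly_time_right: "poly_time_fun f \<Longrightarrow> poly_time_fun (\<lambda>t. right (f t))"
  by (rule poly_time_comp[where g = right])
    (auto intro: poly_time_fun_exp[of "RightE (V 0)" right] simp: size_right_le)

lemma poly_time_Node:
  assumes "poly_time_fun f" "poly_time_fun g"
  shows "poly_time_fun (\<lambda>t. Node (f t) (g t))"
proof -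
  obtain C n q where C: "\<forall>m \<ge> n. computes C m f (poly (q :: nat poly))"
    using poly_time_funE[OF assms(1)] by metis
  obtain D n' r where D: "\<forall>m \<ge> n'. computes D m g (poly (r :: nat poly))"
    using poly_time_funE[OF assms(2)] by metis
  \<comment> \<open>\<open>Suc\<close> keeps \<open>m\<close> apart from variable 0. Both programs
    preserve \<open>m\<close>, which stores the input, and \<open>Suc m\<close>, which stores the
    result of \<open>f\<close>.\<close>
  define m where "m = Suc (max n n')"
  have m: "0 < m" by (simp add: m_def)
  have Cm: "computes C m f (poly q)" and Dm: "computes D m g (poly r)" using C D by (simp_all add: m_def)
  let ?P = "Seq (Assign m (V 0)) (Seq C (Seq (Assign (Suc m) (V 0)) (Seq (Assign 0 (V m))
    (Seq D (Assign 0 (NodeE (V (Suc m)) (V 0)))))))"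
  show ?thesis
  proof (rule poly_time_funI)
    show "computes ?P (m + 2) (\<lambda>t. Node (f t) (g t)) (\<lambda>k. 20 + poly q k + poly r k)"
      unfolding computes_def
    proof
      fix \<sigma> :: state
      obtain k \<sigma>1 where C': "exec C (\<sigma>(m := \<sigma> 0)) k \<sigma>1" "\<sigma>1 0 = f (\<sigma> 0)"
        "\<forall>i \<ge> m. \<sigma>1 i = (\<sigma>(m := \<sigma> 0)) i"
        "k \<le> poly q (size (\<sigma> 0))" "size (f (\<sigma> 0)) \<le> poly q (size (\<sigma> 0))"
        using computesD[OF Cm, of "\<sigma>(m := \<sigma> 0)"] m by (auto)
      define \<sigma>2 where "\<sigma>2 = \<sigma>1(Suc m := f (\<sigma> 0), 0 := \<sigma> 0)"
      obtain l \<sigma>3 where D': "exec D \<sigma>2 l \<sigma>3" "\<sigma>3 0 = g (\<sigma> 0)" "\<forall>i \<ge> m. \<sigma>3 i = \<sigma>2 i"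
        "l \<le> poly r (size (\<sigma> 0))" "size (g (\<sigma> 0)) \<le> poly r (size (\<sigma> 0))"
        using computesD[OF Dm, of \<sigma>2] m by (auto simp: \<sigma>2_def)
      define \<tau> where "\<tau> = \<sigma>3(0 := Node (f (\<sigma> 0)) (g (\<sigma> 0)))"
      have 1: "exec (Assign m (V 0)) \<sigma> 2 (\<sigma>(m := \<sigma> 0))"
        using exec.Assign[of m "V 0" \<sigma>] by (simp add: eval_nat_numeral)
      have 2: "exec (Assign (Suc m) (V 0)) \<sigma>1 2 (\<sigma>1(Suc m := f (\<sigma> 0)))"
        using exec.Assign[of "Suc m" "V 0" \<sigma>1] C' by (simp add: eval_nat_numeral)
      have 3: "exec (Assign 0 (V m)) (\<sigma>1(Suc m := f (\<sigma> 0))) 2 \<sigma>2"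
        using exec.Assign[of 0 "V m" "\<sigma>1(Suc m := f (\<sigma> 0))"] C'(3)[rule_format, of m]
        by (simp add: \<sigma>2_def eval_nat_numeral)
      have 4: "exec (Assign 0 (NodeE (V (Suc m)) (V 0))) \<sigma>3 4 \<tau>"
        using exec.Assign[of 0 "NodeE (V (Suc m)) (V 0)" \<sigma>3] D'
        by (simp add: \<tau>_def \<sigma>2_def eval_nat_numeral)
      have "exec ?P \<sigma> (2 + (k + (2 + (2 + (l + 4))))) \<tau>"
        by (intro exec.Seq[OF 1] exec.Seq[OF C'(1)] exec.Seq[OF 2] exec.Seq[OF 3] exec.Seq[OF D'(1) 4])
      moreover have "\<tau> i = \<sigma> i" if "m + 2 \<le> i" for i
        using that C'(3)[rule_format, of i] D'(3)[rule_format, of i] by (simp add: \<tau>_def \<sigma>2_def)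
      ultimately show "\<exists>k \<tau>. exec ?P \<sigma> k \<tau> \<and> \<tau> 0 = Node (f (\<sigma> 0)) (g (\<sigma> 0)) \<and>
        (\<forall>i \<ge> m + 2. \<tau> i = \<sigma> i) \<and> k \<le> 20 + poly q (size (\<sigma> 0)) + poly r (size (\<sigma> 0)) \<and>
        size (Node (f (\<sigma> 0)) (g (\<sigma> 0))) \<le> 20 + poly q (size (\<sigma> 0)) + poly r (size (\<sigma> 0))"
        using C'(4,5) D'(4,5)
        by (intro exI[of _ "2 + (k + (2 + (2 + (l + 4))))"] exI[of _ \<tau>]) (auto simp: \<tau>_def)
    qed
  qed (intro poly_bounded_intros)
qed

text \<open>The argument of the branches is kept in the right component of the pair that is tested.\<close>

lemma poly_time_If:
  assumes "poly_time_fun b" "poly_time_fun f" "poly_time_fun g"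
  shows "poly_time_fun (\<lambda>t. if b t = Atom then f t else g t)"
proof -
  obtain C n q where C: "\<forall>m \<ge> n. computes C m f (poly (q :: nat poly))"
    using poly_time_funE[OF assms(2)] by metis
  obtain D n' r where D: "\<forall>m \<ge> n'. computes D m g (poly (r :: nat poly))"
    using poly_time_funE[OF assms(3)] by metis
  define m where "m = Suc (max n n')"
  have m: "0 < m" by (simp add: m_def)
  have Cm: "computes C m f (poly q)" and Dm: "computes D m g (poly r)" using C D by (simp_all add: m_def)
  let ?h = "\<lambda>t. if left t = Atom then f (right t) else g (right t)"
  let ?R = "Assign 0 (RightE (V 0))"
  \<comment> \<open>\<open>Cond\<close> treats every tree other than \<open>Atom\<close> as true, so
    the program for \<open>g\<close> comes first.\<close>
  let ?P = "Cond (LeftE (V 0)) (Seq ?R D) (Seq ?R C)"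
  have "poly_time_fun ?h"
  proof (rule poly_time_funI)
    show "computes ?P m ?h (\<lambda>k. 6 + poly q k + poly r k)"
      unfolding computes_def
    proof
      fix \<sigma> :: state
      let ?\<sigma> = "\<sigma>(0 := right (\<sigma> 0))"
      have R: "exec ?R \<sigma> 3 ?\<sigma>" using exec.Assign[of 0 "RightE (V 0)" \<sigma>] by (simp add: eval_nat_numeral)
      have mono: "poly p (size (right (\<sigma> 0))) \<le> poly p (size (\<sigma> 0))" for p :: "nat poly"
        by (intro poly_nat_mono size_right_le)
      show "\<exists>k \<tau>. exec ?P \<sigma> k \<tau> \<and> \<tau> 0 = ?h (\<sigma> 0) \<and> (\<forall>i \<ge> m. \<tau> i = \<sigma> i) \<and>
        k \<le> 6 + poly q (size (\<sigma> 0)) + poly r (size (\<sigma> 0)) \<and>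
        size (?h (\<sigma> 0)) \<le> 6 + poly q (size (\<sigma> 0)) + poly r (size (\<sigma> 0))"
      proof (cases "left (\<sigma> 0) = Atom")
        case True
        obtain k \<tau> where "exec C ?\<sigma> k \<tau>" "\<tau> 0 = f (right (\<sigma> 0))" "\<forall>i \<ge> m. \<tau> i = ?\<sigma> i"
          "k \<le> poly q (size (right (\<sigma> 0)))" "size (f (right (\<sigma> 0))) \<le> poly q (size (right (\<sigma> 0)))"
          using computesD[OF Cm, of ?\<sigma>] m by (auto)
        then show ?thesis
          using exec.CondFalse[of "LeftE (V 0)" \<sigma> "Seq ?R C" "3 + k" \<tau> "Seq ?R D"] True
            exec.Seq[OF R, of C k \<tau>] mono[of q]
          by (intro exI[of _ "6 + k"] exI[of _ \<tau>]) (auto simp: m_def)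
      next
        case False
        obtain k \<tau> where "exec D ?\<sigma> k \<tau>" "\<tau> 0 = g (right (\<sigma> 0))" "\<forall>i \<ge> m. \<tau> i = ?\<sigma> i"
          "k \<le> poly r (size (right (\<sigma> 0)))" "size (g (right (\<sigma> 0))) \<le> poly r (size (right (\<sigma> 0)))"
          using computesD[OF Dm, of ?\<sigma>] m by (auto)
        then show ?thesis
          using exec.CondTrue[of "LeftE (V 0)" \<sigma> "Seq ?R D" "3 + k" \<tau> "Seq ?R C"] False
            exec.Seq[OF R, of D k \<tau>] mono[of r]
          by (intro exI[of _ "6 + k"] exI[of _ \<tau>]) (auto simp: m_def)
      qed
    qed
  qed (intro poly_bounded_intros)
  from poly_time_comp[OF poly_time_Node[OF assms(1) poly_time_id] this] show ?thesis by (simp cong: if_cong)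
qed

section \<open>Folds over lists in polynomial time\<close>

fun tree_fold :: "(tree \<Rightarrow> tree \<Rightarrow> tree) \<Rightarrow> tree \<Rightarrow> tree \<Rightarrow> tree" where
  "tree_fold h Atom a = a"
| "tree_fold h (Node e l) a = tree_fold h l (h e a)"

text \<open>Growth per step is additive: the entry, a constant and a quantity \<open>\<mu>\<close>
  that never increases. A nonzero \<open>\<mu>\<close> permits nested folds, where the inner fold
  runs over a list kept in the accumulator.\<close>

locale tree_step =
  fixes h :: "tree \<Rightarrow> tree \<Rightarrow> tree" and \<mu> :: "tree \<Rightarrow> nat" and \<kappa> :: nat
  assumes size_step: "size (h e a) \<le> size e + size a + \<kappa> + \<mu> a"
    and \<mu>_step: "\<mu> (h e a) \<le> \<mu> a"
    and \<mu>_le_size: "\<mu> a \<le> \<kappa> * size a"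
begin

text \<open>A potential argument: consuming \<open>Node e l\<close> releases
  \<open>(size e + 1) * (\<kappa> + 1 + \<mu> a)\<close>, which pays for the growth of the
  accumulator.\<close>

lemma size_step_budget: "size (h e a) + size l * (\<kappa> + 1 + \<mu> (h e a)) \<le> size a + size (Node e l) * (\<kappa> + 1 + \<mu> a)"
proof -
  let ?X = "\<kappa> + 1 + \<mu> a"
  have "size l * (\<kappa> + 1 + \<mu> (h e a)) \<le> size l * ?X"
    by (intro mult_left_mono) (use \<mu>_step in auto)
  moreover have "size e * 1 \<le> size e * ?X" by (intro mult_left_mono) auto
  moreover have "size (Node e l) * ?X = size e * ?X + size l * ?X + ?X"
    by (simp add: add_mult_distrib del: add_mult_distrib2)
  ultimately show ?thesis using size_step[of e a] by linarith
qed

lemma size_tree_fold: "size (tree_fold h l a) \<le> size a + size l * (\<kappa> + 1 + \<mu> a)"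
proof (induction l arbitrary: a)
  case (Node e l)
  then show ?case using size_step_budget[of e a l] by (fastforce intro: le_trans)
qed simp

text \<open>Variable \<open>n\<close> holds the remaining list and variable 0 the accumulator. The
  budget \<open>B\<close> is a loop invariant, so each call of \<open>C\<close> gets a pair of size
  at most \<open>1 + B\<close>.\<close>

lemma exec_fold_loop:
  assumes C: "computes C n (\<lambda>t. h (left t) (right t)) (poly q)" and "0 < n"
  shows "size a + size l * (\<kappa> + 1 + \<mu> a) \<le> B \<Longrightarrow> \<sigma> 0 = a \<Longrightarrow> \<sigma> n = l \<Longrightarrow>
    \<exists>k \<tau>. exec (While (V n) (Seq (Assign 0 (NodeE (LeftE (V n)) (V 0))) (Seq C (Assign n (RightE (V n)))))) \<sigma> k \<tau> \<and>
      \<tau> 0 = tree_fold h l a \<and> (\<forall>i > n. \<tau> i = \<sigma> i) \<and> k \<le> 2 + size l * (10 + poly q (1 + B))"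
proof (induction l arbitrary: a \<sigma>)
  case Atom
  then show ?case using exec.WhileFalse[of "V n" \<sigma>] by fastforce
next
  case (Node e l)
  let ?\<sigma>1 = "\<sigma>(0 := Node e a)"
  let ?A = "Assign 0 (NodeE (LeftE (V n)) (V 0))" and ?N = "Assign n (RightE (V n))"
  obtain k \<sigma>2 where C': "exec C ?\<sigma>1 k \<sigma>2" "\<sigma>2 0 = h e a" "\<forall>i \<ge> n. \<sigma>2 i = ?\<sigma>1 i"
    "k \<le> poly q (size (Node e a))"
    using computesD[OF C, of ?\<sigma>1] by auto
  let ?\<sigma>3 = "\<sigma>2(n := l)"
  have "size e \<le> size (Node e l) * 1" by simp
  also have "\<dots> \<le> size (Node e l) * (\<kappa> + 1 + \<mu> a)" by (intro mult_left_mono) auto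
  finally have "size (Node e a) \<le> 1 + B" using Node.prems(1) by (simp del: mult_Suc mult_Suc_right)
  from le_trans[OF C'(4) poly_nat_mono[OF this]] have k: "k \<le> poly q (1 + B)" .
  have budget: "size (h e a) + size l * (\<kappa> + 1 + \<mu> (h e a)) \<le> B"
    using size_step_budget Node.prems(1) by (rule le_trans)
  have "?\<sigma>3 0 = h e a" "?\<sigma>3 n = l" using C'(2) \<open>0 < n\<close> by simp_all
  from Node.IH(2)[OF budget this] obtain k' \<tau> where
    \<tau>: "exec (While (V n) (Seq ?A (Seq C ?N))) ?\<sigma>3 k' \<tau>" "\<tau> 0 = tree_fold h l (h e a)"
      "\<forall>i > n. \<tau> i = ?\<sigma>3 i" "k' \<le> 2 + size l * (10 + poly q (1 + B))"
    by blast
  have 1: "exec ?A \<sigma> 5 ?\<sigma>1"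
    using exec.Assign[of 0 "NodeE (LeftE (V n)) (V 0)" \<sigma>] Node.prems \<open>0 < n\<close>
    by (simp add: eval_nat_numeral)
  have 2: "exec ?N \<sigma>2 3 ?\<sigma>3"
    using exec.Assign[of n "RightE (V n)" \<sigma>2] C'(3)[rule_format, of n] Node.prems \<open>0 < n\<close>
    by (simp add: eval_nat_numeral)
  have "exec (While (V n) (Seq ?A (Seq C ?N))) \<sigma> (1 + cost (V n) + (5 + (k + 3)) + k') \<tau>"
    using Node.prems by (intro exec.WhileTrue[OF _ exec.Seq[OF 1 exec.Seq[OF C'(1) 2]] \<tau>(1)]) auto
  moreover have "\<tau> i = \<sigma> i" if "n < i" for i using \<tau>(3)[rule_format, OF that] C'(3)[rule_format, of i] that by auto
  \<comment> \<open>A round costs 2 for the test and 5 and 3 for the two assignments, besides the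
    run of \<open>C\<close>.\<close>
  moreover have "1 + cost (V n) + (5 + (k + 3)) + k' \<le> 2 + size (Node e l) * (10 + poly q (1 + B))"
    using \<tau>(4) k by (simp add: algebra_simps)
  ultimately show ?case using \<tau>(2) by (metis tree_fold.simps(2))
qed

lemma poly_time_tree_fold:
  assumes "poly_time_fun (\<lambda>t. h (left t) (right t))" "poly_time_fun f" "poly_time_fun g"
  shows "poly_time_fun (\<lambda>t. tree_fold h (f t) (g t))"
proof -
  obtain C n' q where C': "\<forall>m \<ge> n'. computes C m (\<lambda>t. h (left t) (right t)) (poly (q :: nat poly))"
    using poly_time_funE[OF assms(1)] by metis
  define n where "n = Suc n'"
  have C: "computes C n (\<lambda>t. h (left t) (right t)) (poly q)" using C' by (simp add: n_def)
  let ?f = "\<lambda>t. tree_fold h (left t) (right t)"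
  let ?L = "While (V n) (Seq (Assign 0 (NodeE (LeftE (V n)) (V 0))) (Seq C (Assign n (RightE (V n)))))"
  let ?P = "Seq (Assign n (LeftE (V 0))) (Seq (Assign 0 (RightE (V 0))) ?L)"
  \<comment> \<open>The budget when accumulator and list have size at most \<open>k\<close>, with
    \<open>\<mu>\<close> replaced by its bound \<open>\<kappa> * k\<close>.\<close>
  let ?B = "\<lambda>k. k + k * (\<kappa> + 1 + \<kappa> * k)"
  have "poly_time_fun ?f"
  proof (rule poly_time_funI)
    show "computes ?P (Suc n) ?f (\<lambda>k. 8 + k * (10 + poly q (1 + ?B k)) + ?B k)"
      unfolding computes_def
    proof
      fix \<sigma> :: state
      let ?l = "left (\<sigma> 0)" and ?a = "right (\<sigma> 0)"
      let ?s = "size (\<sigma> 0)"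
      define \<sigma>2 where "\<sigma>2 = \<sigma>(n := ?l, 0 := ?a)"
      have B: "size ?a + size ?l * (\<kappa> + 1 + \<mu> ?a) \<le> ?B ?s"
        using size_left_le[of "\<sigma> 0"] size_right_le[of "\<sigma> 0"]
        by (intro add_mono mult_mono le_trans[OF \<mu>_le_size]) auto
      have "\<sigma>2 0 = ?a" "\<sigma>2 n = ?l" by (auto simp: \<sigma>2_def n_def)
      from exec_fold_loop[OF C _ B this] obtain k \<tau> where
        L: "exec ?L \<sigma>2 k \<tau>" "\<tau> 0 = ?f (\<sigma> 0)" "\<forall>i > n. \<tau> i = \<sigma>2 i"
          "k \<le> 2 + size ?l * (10 + poly q (1 + ?B ?s))" by (auto simp: n_def)
      have 1: "exec (Assign n (LeftE (V 0))) \<sigma> 3 (\<sigma>(n := ?l))"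
        using exec.Assign[of n "LeftE (V 0)" \<sigma>] by (simp add: eval_nat_numeral)
      have 2: "exec (Assign 0 (RightE (V 0))) (\<sigma>(n := ?l)) 3 \<sigma>2"
        using exec.Assign[of 0 "RightE (V 0)" "\<sigma>(n := ?l)"]
        by (simp add: eval_nat_numeral \<sigma>2_def n_def)
      have "exec ?P \<sigma> (3 + (3 + k)) \<tau>" by (intro exec.Seq[OF 1 exec.Seq[OF 2 L(1)]])
      moreover have "\<tau> i = \<sigma> i" if "Suc n \<le> i" for i using L(3)[rule_format, of i] that by (simp add: \<sigma>2_def)
      moreover have "size ?l * (10 + poly q (1 + ?B ?s)) \<le> ?s * (10 + poly q (1 + ?B ?s))"
        by (intro mult_right_mono size_left_le) auto
      then have "3 + (3 + k) \<le> 8 + ?s * (10 + poly q (1 + ?B ?s)) + ?B ?s" using L(4) by linarith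
      moreover have "size (?f (\<sigma> 0)) \<le> 8 + ?s * (10 + poly q (1 + ?B ?s)) + ?B ?s"
        using size_tree_fold[of ?l ?a] B by linarith
      ultimately show "\<exists>k \<tau>. exec ?P \<sigma> k \<tau> \<and> \<tau> 0 = ?f (\<sigma> 0) \<and> (\<forall>i \<ge> Suc n. \<tau> i = \<sigma> i) \<and>
        k \<le> 8 + ?s * (10 + poly q (1 + ?B ?s)) + ?B ?s \<and>
        size (?f (\<sigma> 0)) \<le> 8 + ?s * (10 + poly q (1 + ?B ?s)) + ?B ?s"
        using L(2) by blast
    qed
  qed (intro poly_bounded_intros)
  from poly_time_comp[OF poly_time_Node[OF assms(2,3)] this] show ?thesis by simp
qed

end

lemmas poly_time_intros = poly_time_id poly_time_Atom poly_time_left poly_time_right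
  poly_time_Node poly_time_If

subsection \<open>The decision procedure\<close>

lemma size_left_right_le: "size (left t) + size (right t) \<le> size t"
  by (cases t) simp_all

abbreviation true_tree :: tree where
  "true_tree \<equiv> Node Atom Atom"

definition equal_step :: "tree \<Rightarrow> tree \<Rightarrow> tree" where
  "equal_step b a = Node (right (left a))
     (if left a = Atom then Atom
      else if b = Atom then (if left (left a) = Atom then right a else Atom)
      else (if left (left a) = Atom then Atom else right a))"

text \<open>The outer test rejects a second number with bits left over.\<close>

definition equal_tree :: "tree \<Rightarrow> tree \<Rightarrow> tree" where
  "equal_tree x y =
     (if left (tree_fold equal_step x (Node y true_tree)) = Atom
      then right (tree_fold equal_step x (Node y true_tree)) else Atom)"

text \<open>A step sees only the entry and the accumulator, so the element sought travels unchanged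
  in the accumulator.\<close>

definition member_step :: "tree \<Rightarrow> tree \<Rightarrow> tree" where
  "member_step e a = Node (left a) (if equal_tree (left a) e = Atom then right a else true_tree)"

definition member_tree :: "tree \<Rightarrow> tree \<Rightarrow> tree" where
  "member_tree x l = right (tree_fold member_step l (Node x Atom))"

text \<open>The list \<open>R\<close> of reached vertices may contain repetitions; a step lengthens
  it by at most one head.\<close>

definition arc_step :: "tree \<Rightarrow> tree \<Rightarrow> tree" where
  "arc_step e R = (if right (right e) = Atom then R
     else if member_tree (left e) R = Atom then R else Node (left (right e)) R)"

text \<open>The first argument only counts the rounds.\<close>

definition round_step :: "tree \<Rightarrow> tree \<Rightarrow> tree" where
  "round_step e a = Node (left a) (tree_fold arc_step (left a) (right a))"

definition reach_tree :: "tree \<Rightarrow> tree \<Rightarrow> tree \<Rightarrow> tree" where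
  "reach_tree A s t = member_tree t (right (tree_fold round_step A (Node A (Node s Atom))))"

text \<open>The state is \<open>((reversed prefix, suffix), ((s, t), flag))\<close>, where the arc list is the
  prefix followed by the suffix.\<close>

definition deletion_step :: "tree \<Rightarrow> tree \<Rightarrow> tree" where
  "deletion_step e a = Node (Node (Node e (left (left a))) (right (right (left a))))
     (Node (left (right a))
       (if reach_tree (tree_fold Node (left (left a)) (right (right (left a))))
          (left (left (right a))) (right (left (right a))) = Atom
        then Atom else right (right a)))"

text \<open>The initial flag records reachability without any deletion, which settles an empty arc
  list and deletions beyond its end.\<close>

definition bridgeless_tree :: "tree \<Rightarrow> tree \<Rightarrow> tree \<Rightarrow> tree" where
  "bridgeless_tree A s t = right (right (tree_fold deletion_step A
     (Node (Node Atom A) (Node (Node s t) (reach_tree A s t)))))"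

section \<open>Polynomial running time of the procedure\<close>

interpretation equal_step: tree_step equal_step "\<lambda>_. 0" 3
proof
  fix e a
  show "size (equal_step e a) \<le> size e + size a + 3 + 0"
    using size_left_right_le[of a] size_right_le[of "left a"] by (auto simp: equal_step_def)
qed simp_all

lemma poly_time_equal_tree:
  assumes "poly_time_fun f" "poly_time_fun g"
  shows "poly_time_fun (\<lambda>t. equal_tree (f t) (g t))"
proof -
  have "poly_time_fun (\<lambda>t. equal_step (left t) (right t))"
    unfolding equal_step_def by (intro poly_time_intros)
  then show ?thesis
    unfolding equal_tree_def by (intro poly_time_intros equal_step.poly_time_tree_fold assms)
qed

interpretation member_step: tree_step member_step "\<lambda>_. 0" 3
proof
  fix e a
  show "size (member_step e a) \<le> size e + size a + 3 + 0"
    using size_left_right_le[of a] by (auto simp: member_step_def)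
qed simp_all

lemma poly_time_member_tree:
  assumes "poly_time_fun f" "poly_time_fun g"
  shows "poly_time_fun (\<lambda>t. member_tree (f t) (g t))"
proof -
  have "poly_time_fun (\<lambda>t. member_step (left t) (right t))"
    unfolding member_step_def by (intro poly_time_intros poly_time_equal_tree)
  then show ?thesis
    unfolding member_tree_def by (intro poly_time_intros member_step.poly_time_tree_fold assms)
qed

interpretation arc_step: tree_step arc_step "\<lambda>_. 0" 1
proof
  fix e a
  show "size (arc_step e a) \<le> size e + size a + 1 + 0"
    using size_left_le[of "right e"] size_right_le[of e] by (auto simp: arc_step_def)
qed simp_all

text \<open>The inner fold may add 2 units of size per unit of the arc list \<open>left a\<close>,
  the factor being \<open>\<kappa> + 1\<close> for \<open>arc_step\<close>. The arc list is the same
  in all rounds, so \<open>\<mu>\<close> stays constant.\<close>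

interpretation round_step: tree_step round_step "\<lambda>a. 2 * size (left a)" 2
proof
  fix e a
  show "size (round_step e a) \<le> size e + size a + 2 + 2 * size (left a)"
    using size_left_right_le[of a] arc_step.size_tree_fold[of "left a" "right a"]
    by (simp add: round_step_def)
qed (simp_all add: round_step_def size_left_le)

lemma poly_time_reach_tree:
  assumes "poly_time_fun f" "poly_time_fun g" "poly_time_fun h"
  shows "poly_time_fun (\<lambda>t. reach_tree (f t) (g t) (h t))"
proof -
  have arc: "poly_time_fun (\<lambda>t. arc_step (left t) (right t))"
    unfolding arc_step_def by (intro poly_time_intros poly_time_member_tree)
  have "poly_time_fun (\<lambda>t. round_step (left t) (right t))"
    unfolding round_step_def by (intro poly_time_intros arc_step.poly_time_tree_fold arc)
  then show ?thesis
    unfolding reach_tree_def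
    by (intro poly_time_intros poly_time_member_tree round_step.poly_time_tree_fold assms)
qed

interpretation Node: tree_step Node "\<lambda>_. 0" 1
  by unfold_locales simp_all

text \<open>Of the reachability test only the flag survives, and it can only shrink; the state grows
  by the entry and a constant.\<close>

interpretation deletion_step: tree_step deletion_step "\<lambda>_. 0" 4
proof
  fix e a
  show "size (deletion_step e a) \<le> size e + size a + 4 + 0"
    using size_left_right_le[of a] size_left_right_le[of "left a"] size_left_right_le[of "right a"]
      size_right_le[of "right (left a)"]
    by (simp add: deletion_step_def)
qed simp_all

lemma poly_time_bridgeless_tree:
  assumes "poly_time_fun f" "poly_time_fun g" "poly_time_fun h"
  shows "poly_time_fun (\<lambda>t. bridgeless_tree (f t) (g t) (h t))"
proof -
  have "poly_time_fun (\<lambda>t. deletion_step (left t) (right t))"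
    unfolding deletion_step_def
    by (intro poly_time_intros poly_time_reach_tree Node.poly_time_tree_fold)
  then show ?thesis
    unfolding bridgeless_tree_def
    by (intro poly_time_intros poly_time_reach_tree deletion_step.poly_time_tree_fold assms)
qed

section \<open>Correctness of comparison and membership on encodings\<close>

lemma enc_nat_eq_Atom_iff [simp]: "enc_nat n = Atom \<longleftrightarrow> n = 0"
  by (subst enc_nat.simps) simp

lemma right_enc_nat: "right (enc_nat n) = enc_nat (n div 2)"
  by (subst enc_nat.simps) (simp add: enc_nat.simps)

lemma left_enc_nat: "left (enc_nat n) = Atom \<longleftrightarrow> even n"
  by (subst enc_nat.simps) simp

text \<open>Induction on \<open>m\<close> by halving: two numbers agree iff their parities and their
  halves do. The flag is arbitrary because a mismatch found earlier must persist.\<close>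

lemma tree_fold_equal_step:
  "(left (tree_fold equal_step (enc_nat m) (Node (enc_nat n) b)) = Atom \<and>
    right (tree_fold equal_step (enc_nat m) (Node (enc_nat n) b)) \<noteq> Atom) \<longleftrightarrow> m = n \<and> b \<noteq> Atom"
proof (induction m arbitrary: n b rule: less_induct)
  case (less m)
  show ?case
  proof (cases "m = 0")
    case False
    \<comment> \<open>The flag after the lowest bit; \<open>n = 0\<close> is a mismatch here because
      \<open>m\<close> is positive.\<close>
    define b' where "b' = (if n = 0 then Atom else if odd m = odd n then b else Atom)"
    have step: "tree_fold equal_step (enc_nat m) (Node (enc_nat n) b)
        = tree_fold equal_step (enc_nat (m div 2)) (Node (enc_nat (n div 2)) b')"
      using False by (subst enc_nat.simps)
        (auto simp: equal_step_def right_enc_nat left_enc_nat b'_def)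
    have "m = n \<longleftrightarrow> odd m = odd n \<and> m div 2 = n div 2"
      by (metis div_mult_mod_eq even_iff_mod_2_eq_zero odd_iff_mod_2_eq_one)
    then show ?thesis
      unfolding step using False less.IH[of "m div 2" "n div 2" b'] by (auto simp: b'_def)
  qed (auto simp: enc_nat.simps[of 0])
qed

lemma equal_tree_enc_nat: "equal_tree (enc_nat m) (enc_nat n) = Atom \<longleftrightarrow> m \<noteq> n"
  using tree_fold_equal_step[of m n true_tree] by (auto simp: equal_tree_def)

lemma tree_fold_enc_list: "tree_fold h (enc_list f xs) a = fold (\<lambda>x. h (f x)) xs a"
  by (induction xs arbitrary: a) simp_all

lemma fold_member_step:
  "left (fold (\<lambda>y. member_step (enc_nat y)) ys (Node (enc_nat x) b)) = enc_nat x \<and>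
   (right (fold (\<lambda>y. member_step (enc_nat y)) ys (Node (enc_nat x) b)) \<noteq> Atom \<longleftrightarrow> x \<in> set ys \<or> b \<noteq> Atom)"
proof (induction ys arbitrary: b)
  case (Cons y ys)
  have "member_step (enc_nat y) (Node (enc_nat x) b) = Node (enc_nat x) (if x = y then true_tree else b)"
    by (simp add: member_step_def equal_tree_enc_nat)
  then show ?case using Cons.IH by simp
qed simp

lemma member_tree_enc_nat: "member_tree (enc_nat x) (enc_list enc_nat ys) \<noteq> Atom \<longleftrightarrow> x \<in> set ys"
  using fold_member_step[of ys x Atom] by (simp add: member_tree_def tree_fold_enc_list)

section \<open>Reachability by rounds of propagation\<close>

abbreviation enc_arc :: "nat \<times> nat \<times> nat \<Rightarrow> tree" where
  "enc_arc \<equiv> enc_pair enc_nat (enc_pair enc_nat enc_nat)"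

text \<open>The counterpart of \<open>arc_step\<close> on unencoded lists, for which the search is
  proved correct.\<close>

fun propagate :: "nat \<times> nat \<times> nat \<Rightarrow> nat list \<Rightarrow> nat list" where
  "propagate (u, v, c) R = (if 0 < c \<and> u \<in> set R then v # R else R)"

text \<open>Parallel arcs collapse in this relation, so an arc has to be deleted from the list
  before the relation is formed.\<close>

definition arc_ends :: "(nat \<times> nat \<times> nat) list \<Rightarrow> (nat \<times> nat) set" where
  "arc_ends al = {(u, v). \<exists>c. 0 < c \<and> (u, v, c) \<in> set al}"

lemma set_propagate_mono: "set R \<subseteq> set (propagate e R)"
  by (cases e) auto

lemma set_fold_propagate_mono: "set R \<subseteq> set (fold propagate al R)"
  by (induction al arbitrary: R) (use set_propagate_mono in fastforce)+

text \<open>When the scan reaches the arc, \<open>u\<close> is still in the list; then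
  \<open>v\<close> is added and never removed.\<close>

lemma fold_propagate_arc:
  assumes "(u, v) \<in> arc_ends al" "u \<in> set R"
  shows "v \<in> set (fold propagate al R)"
proof -
  from assms(1) obtain c xs ys where al: "al = xs @ (u, v, c) # ys" "0 < c"
    by (auto simp: arc_ends_def dest: split_list)
  have "u \<in> set (fold propagate xs R)" using set_fold_propagate_mono assms(2) by blast
  then have "v \<in> set (propagate (u, v, c) (fold propagate xs R))" using al(2) by simp
  then show ?thesis using set_fold_propagate_mono unfolding al(1) by fastforce
qed

text \<open>The list \<open>bl\<close> shrinks in the induction while the relation remains that of
  the whole list \<open>al\<close>.\<close>

lemma fold_propagate_reachable:
  assumes "set bl \<subseteq> set al" "set R \<subseteq> {v. (s, v) \<in> (arc_ends al)\<^sup>*}"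
  shows "set (fold propagate bl R) \<subseteq> {v. (s, v) \<in> (arc_ends al)\<^sup>*}"
  using assms
proof (induction bl arbitrary: R)
  case (Cons e bl)
  obtain u v c where e: "e = (u, v, c)" by (cases e)
  have "set (propagate e R) \<subseteq> {v. (s, v) \<in> (arc_ends al)\<^sup>*}"
  proof (cases "0 < c \<and> u \<in> set R")
    case True
    then have "(u, v) \<in> arc_ends al" using Cons.prems e by (auto simp: arc_ends_def)
    then show ?thesis using True Cons.prems e by (auto intro: rtrancl_into_rtrancl)
  qed (use Cons.prems e in auto)
  then show ?case using Cons by simp
qed simp

text \<open>Each round advances at least one step along every chain of arcs, and a shortest chain
  has at most \<open>card (arc_ends al)\<close> steps, hence at most
  \<open>length al\<close>.\<close>

lemma funpow_fold_propagate:
  "t \<in> set ((fold propagate al ^^ length al) [s]) \<longleftrightarrow> (s, t) \<in> (arc_ends al)\<^sup>*"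
proof
  have "set ((fold propagate al ^^ k) [s]) \<subseteq> {v. (s, v) \<in> (arc_ends al)\<^sup>*}" for k
  proof (induction k)
    case (Suc k)
    from fold_propagate_reachable[OF subset_refl this] show ?case by simp
  qed simp
  then show "t \<in> set ((fold propagate al ^^ length al) [s]) \<Longrightarrow> (s, t) \<in> (arc_ends al)\<^sup>*" by blast
next
  assume reach: "(s, t) \<in> (arc_ends al)\<^sup>*"
  have sub: "arc_ends al \<subseteq> (\<lambda>(u, v, c). (u, v)) ` set al" by (force simp: arc_ends_def)
  then have fin: "finite (arc_ends al)" by (rule finite_subset) simp
  have "card (arc_ends al) \<le> card (set al)"
    using sub by (meson List.finite_set card_image_le card_mono finite_imageI le_trans)
  then have card: "card (arc_ends al) \<le> length al" using card_length le_trans by blast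
  from reach obtain n where n: "n \<le> length al" "(s, t) \<in> arc_ends al ^^ n"
    using card unfolding rtrancl_finite_eq_relpow[OF fin] by (auto intro: le_trans)
  have "n \<le> k \<Longrightarrow> (s, t) \<in> arc_ends al ^^ n \<Longrightarrow> t \<in> set ((fold propagate al ^^ k) [s])" for k n t
  proof (induction k arbitrary: n t)
    case (Suc k)
    show ?case
    proof (cases "n \<le> k")
      case True
      then show ?thesis using Suc set_fold_propagate_mono by fastforce
    next
      case False
      then have "n = Suc k" using Suc.prems(1) by simp
      then obtain v where "(s, v) \<in> arc_ends al ^^ k" "(v, t) \<in> arc_ends al"
        using Suc.prems(2) by auto
      then show ?thesis using Suc.IH[of k v] fold_propagate_arc by simp
    qed
  qed simp
  then show "t \<in> set ((fold propagate al ^^ length al) [s])" using n by blast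
qed

lemma arc_step_enc:
  "arc_step (enc_arc e) (enc_list enc_nat R) = enc_list enc_nat (propagate e R)"
  using member_tree_enc_nat by (cases e) (auto simp: arc_step_def)

lemma tree_fold_arc_step:
  "tree_fold arc_step (enc_list enc_arc al) (enc_list enc_nat R) = enc_list enc_nat (fold propagate al R)"
  unfolding tree_fold_enc_list by (induction al arbitrary: R) (simp_all add: arc_step_enc)

lemma tree_fold_round_step:
  "tree_fold round_step (enc_list enc_arc bl) (Node (enc_list enc_arc al) (enc_list enc_nat R))
    = Node (enc_list enc_arc al) (enc_list enc_nat ((fold propagate al ^^ length bl) R))"
  by (induction bl arbitrary: R)
    (simp_all add: round_step_def tree_fold_arc_step funpow_Suc_right del: funpow.simps(2))

lemma reach_tree_enc:
  "reach_tree (enc_list enc_arc al) (enc_nat s) (enc_nat t) = Atom \<longleftrightarrow> (s, t) \<notin> (arc_ends al)\<^sup>*"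
  using tree_fold_round_step[of al al "[s]"] member_tree_enc_nat funpow_fold_propagate
  by (simp add: reach_tree_def) blast

section \<open>Deletion of one arc at a time\<close>

lemma tree_fold_Node_enc:
  "tree_fold Node (enc_list f xs) (enc_list f ys) = enc_list f (rev xs @ ys)"
proof (induction xs arbitrary: ys)
  case (Cons x xs)
  then show ?case using Cons[of "x # ys"] by simp
qed simp

text \<open>Generalised over the processed prefix \<open>xs\<close>. It is stored in reverse, so
  that an arc is moved to it by one \<open>Node\<close>; folding \<open>Node\<close> over it
  restores the order in front of the suffix.\<close>

lemma tree_fold_deletion_step:
  "right (right (tree_fold deletion_step (enc_list enc_arc ys)
     (Node (Node (enc_list enc_arc (rev xs)) (enc_list enc_arc ys)) (Node (Node (enc_nat s) (enc_nat t)) b)))) \<noteq> Atom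
   \<longleftrightarrow> b \<noteq> Atom \<and> (\<forall>i < length ys. (s, t) \<in> (arc_ends (xs @ take i ys @ drop (Suc i) ys))\<^sup>*)"
proof (induction ys arbitrary: xs b)
  case (Cons y ys)
  let ?b = "if (s, t) \<in> (arc_ends (xs @ ys))\<^sup>* then b else Atom"
  have "deletion_step (enc_arc y) (Node (Node (enc_list enc_arc (rev xs)) (enc_list enc_arc (y # ys)))
      (Node (Node (enc_nat s) (enc_nat t)) b))
    = Node (Node (enc_list enc_arc (rev (xs @ [y]))) (enc_list enc_arc ys))
      (Node (Node (enc_nat s) (enc_nat t)) ?b)"
    by (simp add: deletion_step_def tree_fold_Node_enc reach_tree_enc)
  then show ?case
    using Cons.IH[of "xs @ [y]" ?b] by (simp add: All_less_Suc2 del: rev_append)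
qed simp

text \<open>The fold tries the positions inside the list; any larger \<open>f\<close> deletes
  nothing and is covered by the initial flag.\<close>

lemma bridgeless_tree_enc:
  "bridgeless_tree (enc_list enc_arc al) (enc_nat s) (enc_nat t) \<noteq> Atom
   \<longleftrightarrow> (\<forall>f. (s, t) \<in> (arc_ends (take f al @ drop (Suc f) al))\<^sup>*)" (is "_ \<longleftrightarrow> (\<forall>f. ?P f)")
proof -
  have "bridgeless_tree (enc_list enc_arc al) (enc_nat s) (enc_nat t) \<noteq> Atom
      \<longleftrightarrow> (s, t) \<in> (arc_ends al)\<^sup>* \<and> (\<forall>f < length al. ?P f)"
    using tree_fold_deletion_step[of al "[]" s t "reach_tree (enc_list enc_arc al) (enc_nat s) (enc_nat t)"]
    by (simp add: bridgeless_tree_def reach_tree_enc)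
  moreover have "?P f \<longleftrightarrow> (s, t) \<in> (arc_ends al)\<^sup>*" if "length al \<le> f" for f
    using that by simp
  ultimately show ?thesis by (meson le_refl not_le)
qed

text \<open>Deletion acts on a position, not on a value: an equal entry elsewhere, that is a
  parallel arc, remains.\<close>

lemma set_take_drop_Suc:
  "set (take f xs @ drop (Suc f) xs) = {xs ! i | i. i < length xs \<and> i \<noteq> f}"
proof -
  have "set (drop (Suc f) xs) = {xs ! i | i. i < length xs \<and> f < i}"
  proof (intro set_eqI iffI)
    fix x assume "x \<in> set (drop (Suc f) xs)"
    then obtain j where "j < length xs - Suc f" "x = drop (Suc f) xs ! j"
      by (metis in_set_conv_nth length_drop)
    then show "x \<in> {xs ! i | i. i < length xs \<and> f < i}"
      by (intro CollectI exI[of _ "Suc f + j"]) auto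
  next
    fix x assume "x \<in> {xs ! i | i. i < length xs \<and> f < i}"
    then obtain i where i: "x = xs ! i" "i < length xs" "f < i" by blast
    then have "drop (Suc f) xs ! (i - Suc f) = x" "i - Suc f < length (drop (Suc f) xs)" by auto
    then show "x \<in> set (drop (Suc f) xs)" by (metis nth_mem)
  qed
  moreover have "set (take f xs) = {xs ! i | i. i < length xs \<and> i < f}"
    by (auto simp: in_set_conv_nth) (metis nth_take)+
  ultimately show ?thesis by (auto simp: neq_iff)
qed

text \<open>The arcs of \<open>net_digraph N\<close> are the positions in its arc list, so deleting
  the arc \<open>f\<close> is deleting that position.\<close>

lemma bridgeless_net_digraph:
  "bridgeless (support_digraph (net_digraph N) (net_capacity N)) s t
   \<longleftrightarrow> (\<forall>f. (s, t) \<in> (arc_ends (take f (arc_list N) @ drop (Suc f) (arc_list N)))\<^sup>*)"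
proof -
  let ?H = "support_digraph (net_digraph N) (net_capacity N)"
  have "arc_to_ends ?H ` (arcs ?H - {f}) = arc_ends (take f (arc_list N) @ drop (Suc f) (arc_list N))" for f
  proof -
    have "arc_ends (take f (arc_list N) @ drop (Suc f) (arc_list N))
        = {(u, v). \<exists>c i. 0 < c \<and> (u, v, c) = arc_list N ! i \<and> i < length (arc_list N) \<and> i \<noteq> f}"
      unfolding arc_ends_def set_take_drop_Suc by auto
    also have "\<dots> = arc_to_ends ?H ` (arcs ?H - {f})"
    proof (intro set_eqI iffI)
      fix e assume "e \<in> {(u, v). \<exists>c i. 0 < c \<and> (u, v, c) = arc_list N ! i \<and> i < length (arc_list N) \<and> i \<noteq> f}"
      then obtain u v c i where i: "e = (u, v)" "0 < c" "arc_list N ! i = (u, v, c)" "i < length (arc_list N)" "i \<noteq> f"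
        by auto
      then show "e \<in> arc_to_ends ?H ` (arcs ?H - {f})"
        by (intro image_eqI[of _ _ i])
          (simp_all add: arc_to_ends_def support_digraph_def net_digraph_def net_capacity_def)
    next
      fix e assume "e \<in> arc_to_ends ?H ` (arcs ?H - {f})"
      then obtain i where "i < length (arc_list N)" "i \<noteq> f" "0 < net_capacity N i"
        "e = (fst (arc_list N ! i), fst (snd (arc_list N ! i)))"
        by (auto simp: arc_to_ends_def support_digraph_def net_digraph_def)
      then show "e \<in> {(u, v). \<exists>c i. 0 < c \<and> (u, v, c) = arc_list N ! i \<and> i < length (arc_list N) \<and> i \<noteq> f}"
        by (cases "arc_list N ! i") (simp add: net_capacity_def, metis)
    qed
    finally show ?thesis ..
  qed
  then show ?thesis by (simp add: bridgeless_def)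
qed

theorem theorem4p1:
  shows "(\<forall>(D :: ('a, 'b) pre_digraph) s t c.
            flow_network D s t c \<longrightarrow>
            local_arc_connectivity (support_digraph D c) s t \<ge> 2 \<longrightarrow>
            (\<exists>x. maximum_st_flow D s t c x \<and>
                 local_arc_connectivity (support_digraph D x) s t \<ge> 2))
       \<and> poly_time_decidable enc_network networks
           (\<lambda>N. \<exists>x. maximum_st_flow (net_digraph N) (source N) (sink N) (net_capacity N) x \<and>
                local_arc_connectivity (support_digraph (net_digraph N) x) (source N) (sink N) \<ge> 2)"
proof (intro conjI allI impI)
  fix D :: "('a, 'b) pre_digraph" and s t c
  assume net: "flow_network D s t c" and con: "2 \<le> local_arc_connectivity (support_digraph D c) s t"
  interpret fin_digraph D using net by (simp add: flow_network_def)
  have st: "s \<noteq> t" "s \<in> verts D" using net by (simp_all add: flow_network_def)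
  then have "bridgeless (support_digraph D c) s t"
    using con fin_digraph.local_arc_connectivity_ge_2_iff_bridgeless[OF fin_digraph_support]
    by (simp add: support_digraph_def)
  then show "\<exists>x. maximum_st_flow D s t c x \<and> 2 \<le> local_arc_connectivity (support_digraph D x) s t"
    using maximum_flow_connectivity_iff[OF st] by blast
next
  \<comment> \<open>The projections extract the arc list, the source and the sink from
    \<open>enc_network\<close>.\<close>
  let ?f = "\<lambda>i. bridgeless_tree (left (right i)) (left (right (right i))) (right (right (right i)))"
  show "poly_time_decidable enc_network networks
     (\<lambda>N. \<exists>x. maximum_st_flow (net_digraph N) (source N) (sink N) (net_capacity N) x \<and>
          2 \<le> local_arc_connectivity (support_digraph (net_digraph N) x) (source N) (sink N))"
  proof (rule poly_time_decidableI)
    show "poly_time_fun ?f" by (intro poly_time_intros poly_time_bridgeless_tree)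
  next
    fix N assume "N \<in> networks"
    then have net: "flow_network (net_digraph N) (source N) (sink N) (net_capacity N)"
      by (simp add: networks_def)
    interpret fin_digraph "net_digraph N" using net by (simp add: flow_network_def)
    show "?f (enc_network N) \<noteq> Atom \<longleftrightarrow>
      (\<exists>x. maximum_st_flow (net_digraph N) (source N) (sink N) (net_capacity N) x \<and>
        2 \<le> local_arc_connectivity (support_digraph (net_digraph N) x) (source N) (sink N))"
      using net maximum_flow_connectivity_iff[of "source N" "sink N"]
      by (simp add: flow_network_def enc_network_def bridgeless_tree_enc bridgeless_net_digraph)
  qed
qed

end
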